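(* Let $f:\mathbb T\to\mathbb C$ be a continuous analytic function with Fourier coefficients $c_j=\widehat f(j)$, $j\ge 0$. Let $d\ge 2$ and consider the multi-Toeplitz operator $T=f(L_1)+f(L_1)^*$ acting in $\mathcal F_d$. Let $T_N=P_NTP_N$, and for $h=0,1,2,\dots$ let $X_h^f$ be the $(h+1)\times(h+1)$ Toeplitz matrix $$X_h^f=\begin{pmatrix} c_0+\overline{c_0} & \overline{c_1} & \cdots & \overline{c_h}\\ c_1 & c_0+\overline{c_0} & \cdots & \overline{c_{h-1}}\\ \vdots & \ddots & \ddots & \vdots\\ c_h & c_{h-1} & \cdots & c_0+\overline{c_0}\end{pmatrix}.$$ Let $\mu_h^f=\sum_{j=1}^{h+1}\delta_{\lambda_j^{(h)}}$ be the atomic measure with point masses at the eigenvalues $\lambda_1^{(h)},\dots,\lambda_{h+1}^{(h)}$ (with multiplicity) of $X_h^f$. Then the limiting eigenvalue distribution $\mu_T$ of the truncations $T_N$ is purely atomic, and is given by $$\mu_T=\left(1-\frac1d\right)^2\sum_{h=0}^\infty d^{-h}\mu_h^f .$$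
   Context: The Fock space on $d$ generators is the Hilbert space direct sum $\mathcal F_d=\bigoplus_{n=0}^\infty \mathcal H_n$ with $\mathcal H_0=\mathbb C$ and $\mathcal H_n=(\mathbb C^d)^{\otimes n}$ for $n\ge 1$. Let $e_1,\dots,e_d$ be the standard basis of $\mathbb C^d$. For a word $w=i_1\cdots i_n$ in the letters $\{1,\dots,d\}$ of length $|w|=n$, put $\xi_w=e_{i_1}\otimes\cdots\otimes e_{i_n}$ (for the empty word, $\xi_w=1\in\mathcal H_0$); the $\xi_w$ form an orthonormal basis of $\mathcal F_d$. The left shifts are the isometries $L_i\xi=e_i\otimes\xi$ (i.e. $L_i\xi_w=\xi_{iw}$), $i=1,\dots,d$. $P_N$ is the orthogonal projection onto $\mathrm{span}\{\xi_w:|w|\le N\}$, of rank $d_N=1+d+\cdots+d^N$, and $T_N=P_NTP_N$ is regarded as an operator on the range of $P_N$. A continuous function $f$ on the unit circle $\mathbb T$ is analytic if $\widehat f(j)=0$ for all $j<0$ (i.e. $f$ belongs to the disk algebra). For such $f$, $f(L_1)$ is the bounded operator given by the disk algebra functional calculus of the contraction $L_1$: the operator-norm limit of $p_n(L_1)$ for any sequence of analytic polynomials $p_n\to f$ uniformly on $\mathbb T$. In particular $f(L_1)\xi_w=\sum_{j\ge0}c_jL_1^j\xi_w$ for every word $w$. For a bounded self-adjoint operator $T$ on $\mathcal F_d$, the limiting eigenvalue distribution of the truncations $T_N$ is the unique Borel probability measure $\mu_T$ on $\mathbb R$ (when it exists) such that $\lim_{N\to\infty}\frac1{d_N}\sum_{i=1}^{d_N}g(\lambda_i(T_N))=\int_{\mathbb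 R} g\,d\mu_T$ for every continuous $g:\mathbb R\to\mathbb C$, where $\lambda_1(T_N),\dots,\lambda_{d_N}(T_N)$ are the eigenvalues of $T_N$ with multiplicity. It exists whenever $d\ge2$ and $T$ is bounded, self-adjoint and multi-Toeplitz, meaning $R_i^*TR_j=\delta_{ij}T$ for all $i,j$, where $R_i\xi=\xi\otimes e_i$. *)

theory Defs
  imports "HOL-Probability.Probability" "Jordan_Normal_Form.Char_Poly"
begin

section \<open>The Fock space\<close>

text \<open>The letters are the elements of a finite type \<open>'d\<close>, so that the number of generators is
  \<open>CARD('d)\<close> and a word is a list. Since the vectors \<open>\<xi>\<^sub>w\<close> form an orthonormal basis, a vector of the
  Fock space is represented by its square-summable family of coefficients; the words of length
  \<open>n\<close> span the summand \<open>(\<complex>\<^sup>d)\<^sup>\<otimes>\<^sup>n\<close>.\<close>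

definition square_summable :: "('a \<Rightarrow> complex) \<Rightarrow> bool" where
  "square_summable x \<longleftrightarrow> (\<lambda>w. (cmod (x w))\<^sup>2) summable_on UNIV"

lemma square_summable_add:
  assumes "square_summable x" "square_summable y"
  shows "square_summable (\<lambda>w. x w + y w)"
  unfolding square_summable_def
proof (rule summable_on_comparison_test)
  show "(\<lambda>w. 2 * (cmod (x w))\<^sup>2 + 2 * (cmod (y w))\<^sup>2) summable_on UNIV"
    using assms unfolding square_summable_def
    by (intro summable_on_add summable_on_cmult_right)
  show "(cmod (x w + y w))\<^sup>2 \<le> 2 * (cmod (x w))\<^sup>2 + 2 * (cmod (y w))\<^sup>2" for w
  proof -
    have "(cmod (x w + y w))\<^sup>2 \<le> (cmod (x w) + cmod (y w))\<^sup>2"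
      by (intro power_mono norm_triangle_ineq) auto
    also have "\<dots> \<le> 2 * (cmod (x w))\<^sup>2 + 2 * (cmod (y w))\<^sup>2"
      using sum_squares_bound[of "cmod (x w)" "cmod (y w)"] by (simp add: power2_sum)
    finally show ?thesis .
  qed
qed auto

lemma square_summable_scale:
  assumes "square_summable x"
  shows "square_summable (\<lambda>w. c * x w)"
  using assms summable_on_cmult_right[of "\<lambda>w. (cmod (x w))\<^sup>2" UNIV "(cmod c)\<^sup>2"]
  unfolding square_summable_def by (simp add: norm_mult power_mult_distrib)

lemma square_summable_reindex:
  assumes "square_summable x" "inj h"
    and "\<And>w. y (h w) = x w" "\<And>v. v \<notin> range h \<Longrightarrow> y v = 0"
  shows "square_summable y"
proof -
  have "(\<lambda>v. (cmod (y v))\<^sup>2) summable_on range h"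
    using assms by (subst summable_on_reindex) (auto simp: o_def square_summable_def)
  moreover have "(\<lambda>v. (cmod (y v))\<^sup>2) summable_on range h
      \<longleftrightarrow> (\<lambda>v. (cmod (y v))\<^sup>2) summable_on UNIV"
    by (rule summable_on_cong_neutral) (use assms(4) in auto)
  ultimately show ?thesis by (simp add: square_summable_def)
qed

lemma square_summable_mult:
  assumes "square_summable x" "square_summable y"
  shows "(\<lambda>w. x w * cnj (y w)) summable_on UNIV"
proof (rule abs_summable_summable, rule summable_on_comparison_test)
  show "(\<lambda>w. (cmod (x w))\<^sup>2 + (cmod (y w))\<^sup>2) summable_on UNIV"
    using assms unfolding square_summable_def by (intro summable_on_add)
  show "cmod (x w * cnj (y w)) \<le> (cmod (x w))\<^sup>2 + (cmod (y w))\<^sup>2" for w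
  proof -
    have "0 \<le> cmod (x w) * cmod (y w)"
      by simp
    then have "cmod (x w) * cmod (y w) \<le> (cmod (x w))\<^sup>2 + (cmod (y w))\<^sup>2"
      using sum_squares_bound[of "cmod (x w)" "cmod (y w)"] by linarith
    then show ?thesis
      by (simp add: norm_mult)
  qed
qed auto

typedef 'd fock = "{x :: 'd list \<Rightarrow> complex. square_summable x}" morphisms coefficient Abs_fock
  by (rule exI[of _ "\<lambda>_. 0"]) (simp add: square_summable_def)

setup_lifting type_definition_fock

lift_definition scaleC :: "complex \<Rightarrow> 'd fock \<Rightarrow> 'd fock" (infixr "*\<^sub>C" 75)
  is "\<lambda>c x w. c * x w" by (rule square_summable_scale)

lift_definition cinner :: "'d fock \<Rightarrow> 'd fock \<Rightarrow> complex"
  is "\<lambda>x y. \<Sum>\<^sub>\<infinity>w. x w * cnj (y w)" .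

lift_definition \<xi> :: "'d list \<Rightarrow> 'd fock" is "\<lambda>w v. of_bool (v = w)"
  unfolding square_summable_def
  by (rule finite_nonzero_values_imp_summable_on) simp

instantiation fock :: (type) real_vector
begin

lift_definition zero_fock :: "'a fock" is "\<lambda>_. 0"
  by (simp add: square_summable_def)

lift_definition plus_fock :: "'a fock \<Rightarrow> 'a fock \<Rightarrow> 'a fock" is "\<lambda>x y w. x w + y w"
  by (rule square_summable_add)

lift_definition uminus_fock :: "'a fock \<Rightarrow> 'a fock" is "\<lambda>x w. - x w"
  by (simp add: square_summable_def)

lift_definition minus_fock :: "'a fock \<Rightarrow> 'a fock \<Rightarrow> 'a fock" is "\<lambda>x y w. x w - y w"
  subgoal for x y
    using square_summable_add[of x "\<lambda>w. - y w"] by (simp add: square_summable_def)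
  done

definition scaleR_fock :: "real \<Rightarrow> 'a fock \<Rightarrow> 'a fock" where
  "scaleR_fock r x = complex_of_real r *\<^sub>C x"

instance
proof
  fix a b :: real and x y z :: "'a fock"
  show "x + y + z = x + (y + z)" "x + y = y + x" "0 + x = x" "- x + x = 0" "x - y = x + - y"
    by (transfer; auto)+
  show "a *\<^sub>R (x + y) = a *\<^sub>R x + a *\<^sub>R y" "(a + b) *\<^sub>R x = a *\<^sub>R x + b *\<^sub>R x"
    "a *\<^sub>R b *\<^sub>R x = (a * b) *\<^sub>R x" "1 *\<^sub>R x = x"
    unfolding scaleR_fock_def by (transfer; auto simp: algebra_simps)+
qed

end

instantiation fock :: (type) real_inner
begin

definition inner_fock :: "'a fock \<Rightarrow> 'a fock \<Rightarrow> real" where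
  "inner_fock x y = Re (cinner x y)"

definition norm_fock :: "'a fock \<Rightarrow> real" where
  "norm_fock x = sqrt (Re (cinner x x))"

definition dist_fock :: "'a fock \<Rightarrow> 'a fock \<Rightarrow> real" where
  "dist_fock x y = norm (x - y)"

definition sgn_fock :: "'a fock \<Rightarrow> 'a fock" where
  "sgn_fock x = x /\<^sub>R norm x"

definition uniformity_fock :: "('a fock \<times> 'a fock) filter" where
  "uniformity_fock = (INF e\<in>{0<..}. principal {(x, y). dist x y < e})"

definition open_fock :: "'a fock set \<Rightarrow> bool" where
  "open_fock U \<longleftrightarrow> (\<forall>x\<in>U. eventually (\<lambda>(x', y). x' = x \<longrightarrow> y \<in> U) uniformity)"

instance
proof
  fix a :: real and x y z :: "'a fock" and U :: "'a fock set"
  show "dist x y = norm (x - y)" "sgn x = x /\<^sub>R norm x"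
    "(uniformity :: ('a fock \<times> 'a fock) filter) = (INF e\<in>{0<..}. principal {(x, y). dist x y < e})"
    "open U \<longleftrightarrow> (\<forall>x\<in>U. eventually (\<lambda>(x', y). x' = x \<longrightarrow> y \<in> U) uniformity)"
    by (fact dist_fock_def sgn_fock_def uniformity_fock_def open_fock_def)+
  have "cinner y x = cnj (cinner x y)"
    by transfer (simp flip: infsum_cnj add: mult.commute)
  then show "inner x y = inner y x"
    by (simp add: inner_fock_def)
  have "cinner (x + y) z = cinner x z + cinner y z"
    by transfer (simp add: distrib_right infsum_add square_summable_mult)
  then show "inner (x + y) z = inner x z + inner y z"
    by (simp add: inner_fock_def)
  have "cinner (complex_of_real a *\<^sub>C x) y = complex_of_real a * cinner x y"
    by transfer (simp add: mult.assoc infsum_cmult_right')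
  then show "inner (a *\<^sub>R x) y = a * inner x y"
    by (simp add: inner_fock_def scaleR_fock_def)
  have *: "cinner x x = complex_of_real (\<Sum>\<^sub>\<infinity>w. (cmod (coefficient x w))\<^sup>2)" for x :: "'a fock"
  proof -
    have "((\<lambda>w. (cmod (coefficient x w))\<^sup>2) has_sum (\<Sum>\<^sub>\<infinity>w. (cmod (coefficient x w))\<^sup>2)) UNIV"
      using coefficient[of x] by (simp add: square_summable_def)
    from has_sum_of_real[OF this, where ?'a = complex] show ?thesis
      unfolding cinner.rep_eq
      by (intro infsumI) (simp only: complex_norm_square)
  qed
  show "0 \<le> inner x x"
    by (simp add: inner_fock_def * infsum_nonneg)
  show "inner x x = 0 \<longleftrightarrow> x = 0"
  proof
    assume "inner x x = 0"
    then have "(\<Sum>\<^sub>\<infinity>w. (cmod (coefficient x w))\<^sup>2) = 0"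
      by (simp add: inner_fock_def *)
    then have "(cmod (coefficient x w))\<^sup>2 = 0" for w
      using coefficient[of x]
      by (intro nonneg_infsum_le_0D[where A = UNIV]) (auto simp: square_summable_def)
    then show "x = 0"
      by (metis (no_types, lifting) coefficient_inject ext norm_eq_zero power_eq_0_iff
          zero_fock.rep_eq)
  next
    assume "x = 0"
    then show "inner x x = 0"
      by (simp add: inner_fock_def * zero_fock.rep_eq)
  qed
  show "norm x = sqrt (inner x x)"
    by (simp add: norm_fock_def inner_fock_def)
qed

end

lemma cinner_\<xi>: "cinner (\<xi> v) (\<xi> w) = of_bool (v = w)"
proof transfer
  fix v w :: "'a list"
  have "(\<Sum>\<^sub>\<infinity>u. of_bool (u = v) * cnj (of_bool (u = w))) = (\<Sum>\<^sub>\<infinity>u\<in>{v}. (of_bool (v = w) :: complex))"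
    by (rule infsum_cong_neutral) auto
  then show "(\<Sum>\<^sub>\<infinity>u. of_bool (u = v) * cnj (of_bool (u = w))) = (of_bool (v = w) :: complex)"
    by simp
qed

lemma coefficient_eq_cinner: "coefficient x w = cinner x (\<xi> w)"
proof transfer
  fix x :: "'a list \<Rightarrow> complex" and w
  have "(\<Sum>\<^sub>\<infinity>u. x u * cnj (of_bool (u = w))) = (\<Sum>\<^sub>\<infinity>u\<in>{w}. x w)"
    by (rule infsum_cong_neutral) auto
  then show "x w = (\<Sum>\<^sub>\<infinity>u. x u * cnj (of_bool (u = w)))"
    by simp
qed

interpretation fock: vector_space "scaleC :: complex \<Rightarrow> 'd fock \<Rightarrow> 'd fock"
  by unfold_locales (transfer; simp add: algebra_simps)+


section \<open>Operators\<close>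

text \<open>The norm of \<open>'d fock\<close> as a real normed space is the Hilbert space norm, so \<open>onorm\<close> is the
  operator norm.\<close>

definition bounded_clinear :: "('d fock \<Rightarrow> 'd fock) \<Rightarrow> bool" where
  "bounded_clinear A \<longleftrightarrow> bounded_linear A \<and> (\<forall>c x. A (c *\<^sub>C x) = c *\<^sub>C A x)"

definition adj :: "('d fock \<Rightarrow> 'd fock) \<Rightarrow> 'd fock \<Rightarrow> 'd fock" where
  "adj A = (THE B. \<forall>x y. cinner (A x) y = cinner x (B y))"

definition self_adjoint :: "('d fock \<Rightarrow> 'd fock) \<Rightarrow> bool" where
  "self_adjoint A \<longleftrightarrow> (\<forall>x y. cinner (A x) y = cinner x (A y))"

lift_definition left_shift :: "'d \<Rightarrow> 'd fock \<Rightarrow> 'd fock"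
  is "\<lambda>i x w. case w of [] \<Rightarrow> 0 | j # v \<Rightarrow> if j = i then x v else 0"
  subgoal for i x
    by (rule square_summable_reindex[of x "\<lambda>w. i # w"]) (auto split: list.split)
  done

lift_definition right_shift :: "'d \<Rightarrow> 'd fock \<Rightarrow> 'd fock"
  is "\<lambda>i x w. if w \<noteq> [] \<and> last w = i then x (butlast w) else 0"
  subgoal for i x
  proof (rule square_summable_reindex[of x "\<lambda>w. w @ [i]"])
    show "(if v \<noteq> [] \<and> last v = i then x (butlast v) else 0) = 0" if "v \<notin> range (\<lambda>w. w @ [i])" for v
      using that append_butlast_last_id[of v] by (metis rangeI)
  qed (auto simp: inj_def)
  done

lemma left_shift_\<xi>: "left_shift i (\<xi> w) = \<xi> (i # w)"
  by transfer (auto split: list.split)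

lemma right_shift_\<xi>: "right_shift i (\<xi> w) = \<xi> (w @ [i])"
  by transfer (auto simp: fun_eq_iff)

definition multi_Toeplitz :: "('d fock \<Rightarrow> 'd fock) \<Rightarrow> bool" where
  "multi_Toeplitz T \<longleftrightarrow>
    (\<forall>i j. adj (right_shift i) \<circ> T \<circ> right_shift j = (if i = j then T else (\<lambda>_. 0)))"

definition poly_op :: "complex poly \<Rightarrow> ('d fock \<Rightarrow> 'd fock) \<Rightarrow> 'd fock \<Rightarrow> 'd fock" where
  "poly_op p A x = (\<Sum>j\<le>degree p. coeff p j *\<^sub>C (A ^^ j) x)"

text \<open>The disk algebra functional calculus, for a contraction \<open>A\<close> and a function \<open>f\<close> that is
  continuous and analytic on the unit circle.\<close>

definition disk_calculus :: "(complex \<Rightarrow> complex) \<Rightarrow> ('d fock \<Rightarrow> 'd fock) \<Rightarrow> 'd fock \<Rightarrow> 'd fock" where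
  "disk_calculus f A = (THE F. bounded_clinear F \<and>
    (\<forall>p :: nat \<Rightarrow> complex poly. uniform_limit (sphere 0 1) (\<lambda>n. poly (p n)) f sequentially \<longrightarrow>
      (\<lambda>n. onorm (\<lambda>x. poly_op (p n) A x - F x)) \<longlonglongrightarrow> 0))"

definition fourier_coeff :: "(complex \<Rightarrow> complex) \<Rightarrow> int \<Rightarrow> complex" where
  "fourier_coeff f j =
    complex_of_real (1 / (2 * pi)) * integral {0..2 * pi} (\<lambda>t. f (cis t) * cis (- of_int j * t))"


section \<open>Truncations and their limiting eigenvalue distribution\<close>

definition trunc_proj :: "nat \<Rightarrow> 'd::finite fock \<Rightarrow> 'd fock" where
  "trunc_proj N x = (\<Sum>w | length w \<le> N. cinner x (\<xi> w) *\<^sub>C \<xi> w)"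

definition truncation :: "nat \<Rightarrow> ('d::finite fock \<Rightarrow> 'd fock) \<Rightarrow> 'd fock \<Rightarrow> 'd fock" where
  "truncation N T = trunc_proj N \<circ> T \<circ> trunc_proj N"

definition trunc_dim :: "'d::finite itself \<Rightarrow> nat \<Rightarrow> nat" where
  "trunc_dim _ N = (\<Sum>n\<le>N. CARD('d) ^ n)"

text \<open>Eigenvalues of the truncation as an operator on the range of the projection. These notions
  are used for self-adjoint operators only, so all eigenvalues are real and the multiplicity of
  an eigenvalue is the complex dimension of its eigenspace.\<close>

definition trunc_eigenspace :: "nat \<Rightarrow> ('d::finite fock \<Rightarrow> 'd fock) \<Rightarrow> real \<Rightarrow> 'd fock set" where
  "trunc_eigenspace N T r = {x \<in> range (trunc_proj N). truncation N T x = complex_of_real r *\<^sub>C x}"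

definition trunc_eigenvalues :: "nat \<Rightarrow> ('d::finite fock \<Rightarrow> 'd fock) \<Rightarrow> real set" where
  "trunc_eigenvalues N T = {r. \<exists>x \<in> trunc_eigenspace N T r. x \<noteq> 0}"

definition is_limiting_distribution :: "('d::finite fock \<Rightarrow> 'd fock) \<Rightarrow> real measure \<Rightarrow> bool" where
  "is_limiting_distribution T \<mu> \<longleftrightarrow> sets \<mu> = sets borel \<and> prob_space \<mu> \<and>
    (\<forall>g :: real \<Rightarrow> complex. continuous_on UNIV g \<longrightarrow> integrable \<mu> g \<and>
      (\<lambda>N. (\<Sum>r \<in> trunc_eigenvalues N T. of_nat (fock.dim (trunc_eigenspace N T r)) * g r)
            / of_nat (trunc_dim TYPE('d) N)) \<longlonglongrightarrow> (\<integral>t. g t \<partial>\<mu>))"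

definition limiting_distribution :: "('d::finite fock \<Rightarrow> 'd fock) \<Rightarrow> real measure" where
  "limiting_distribution T = (THE \<mu>. is_limiting_distribution T \<mu>)"

definition purely_atomic :: "real measure \<Rightarrow> bool" where
  "purely_atomic \<mu> \<longleftrightarrow> (\<exists>C \<in> sets \<mu>. countable C \<and> emeasure \<mu> (space \<mu> - C) = 0)"


section \<open>Toeplitz matrices and their eigenvalue measures\<close>

definition toeplitz_matrix :: "(complex \<Rightarrow> complex) \<Rightarrow> nat \<Rightarrow> complex mat" where
  "toeplitz_matrix f h = (let c = (\<lambda>j. fourier_coeff f (int j)) in
    Matrix.mat (h + 1) (h + 1) (\<lambda>(i, j).
      if i = j then c 0 + cnj (c 0) else if j < i then c (i - j) else cnj (c (j - i))))"

text \<open>For a Hermitian matrix \<open>X\<close>: the sum of the point masses at the eigenvalues of \<open>X\<close>, each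
  repeated according to its multiplicity. The eigenvalues are real.\<close>

definition eigenvalue_measure :: "complex mat \<Rightarrow> real measure" where
  "eigenvalue_measure X = measure_of UNIV (sets borel) (\<lambda>A.
    \<Sum>r | eigenvalue X (complex_of_real r).
      of_nat (order (complex_of_real r) (char_poly X)) * emeasure (return borel r) A)"

lemma emeasure_eigenvalue_measure:
  assumes "A \<in> sets borel"
  shows "emeasure (eigenvalue_measure X) A =
    (\<Sum>r | eigenvalue X (complex_of_real r).
      of_nat (order (complex_of_real r) (char_poly X)) * emeasure (return borel r) A)"
  unfolding eigenvalue_measure_def
proof (rule emeasure_measure_of_sigma)
  show "sigma_algebra UNIV (sets (borel :: real measure))"
    using sets.sigma_algebra_axioms[of "borel :: real measure"] by simp
  let ?E = "{r. eigenvalue X (complex_of_real r)}"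
  let ?m = "\<lambda>r. of_nat (order (complex_of_real r) (char_poly X)) :: ennreal"
  let ?\<mu> = "\<lambda>A. \<Sum>r\<in>?E. ?m r * emeasure (return borel r) A"
  show "positive (sets borel) ?\<mu>"
    by (simp add: positive_def)
  show "countably_additive (sets borel) ?\<mu>"
  proof (rule countably_additiveI)
    fix A :: "nat \<Rightarrow> real set"
    assume A: "range A \<subseteq> sets borel" "disjoint_family A" "\<Union> (range A) \<in> sets borel"
    have "(\<Sum>i. ?\<mu> (A i)) = (\<Sum>r\<in>?E. \<Sum>i. ?m r * emeasure (return borel r) (A i))"
      by (rule suminf_sum) simp
    also have "\<dots> = (\<Sum>r\<in>?E. ?m r * (\<Sum>i. emeasure (return borel r) (A i)))"
      by simp
    also have "\<dots> = ?\<mu> (\<Union> (range A))"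
      using A by (simp only: suminf_emeasure sets_return)
    finally show "(\<Sum>i. ?\<mu> (A i)) = ?\<mu> (\<Union> (range A))" .
  qed
qed (use assms in simp)

end

theory Submission
  imports Defs "Jordan_Normal_Form.Jordan_Normal_Form_Existence"
begin

text \<open>Write \<open>a\<close> for the letter that the left shift \<open>L\<close> prepends and call a word \<open>v\<close> a block head
  if it does not begin with \<open>a\<close>. Every word is \<open>a\<^sup>k v\<close> for a unique \<open>k\<close> and a unique block head
  \<open>v\<close>, and \<open>L\<close> maps \<open>a\<^sup>k v\<close> to \<open>a\<^sup>k\<^sup>+\<^sup>1 v\<close>. So the Fock space splits into copies of \<open>\<ell>\<^sup>2(\<nat>)\<close>, one for
  each head, on each of which \<open>L\<close> is the unilateral shift and \<open>T = f(L) + f(L)\<^sup>*\<close> is the Toeplitz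
  operator with symbol \<open>f + cnj f\<close>. Truncation to words of length at most \<open>N\<close> cuts the copy with
  head \<open>v\<close> down to its first \<open>h + 1\<close> basis vectors, \<open>h = N - |v|\<close>; hence \<open>T\<^sub>N\<close> is a direct sum of
  the matrices \<open>X\<^sub>h\<close>, one for each head of length \<open>N - h\<close>. There are \<open>(d - 1) d\<^sup>m\<close> heads of length
  \<open>m + 1\<close>, so the proportion of blocks of size \<open>h + 1\<close>, relative to the dimension, tends to
  \<open>(1 - 1/d)\<^sup>2 d\<^sup>-\<^sup>h\<close> and is at most \<open>d\<^sup>-\<^sup>h\<close>. As all eigenvalues lie in \<open>[-\<parallel>T\<parallel>, \<parallel>T\<parallel>]\<close>, dominated
  convergence gives the limit of the eigenvalue averages, and it is the integral against the
  asserted atomic measure.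

  The functional calculus enters through one inequality, von Neumann's inequality for the shift:
  if a polynomial is bounded by \<open>B\<close> on the circle then convolution with its coefficients has norm
  at most \<open>B\<close> on finite sequences, by Parseval's identity (\<open>convolution_bound_poly\<close>). The
  inequality involves finitely many coefficients at a time, so it survives limits and shows that
  the Fourier coefficients of \<open>f\<close> themselves define a bounded operator \<open>shift_series\<close> that is the
  norm limit of \<open>p\<^sub>n(L)\<close> for all polynomials \<open>p\<^sub>n \<rightarrow> f\<close> (\<open>disk_calculus_left_shift\<close>). That such
  polynomials exist is Fejer's theorem (\<open>fejer_uniform_limit\<close>), where analyticity of \<open>f\<close> removes
  the negative frequencies.

  Multiplicities are counted on both sides with one diagonalization \<open>X\<^sub>h = P diag(\<lambda>) P\<^sup>-\<^sup>1\<close>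
  (\<open>hermitian_diagonalization\<close>): the roots of the characteristic polynomial are the \<open>\<lambda>\<^sub>j\<close>, and the
  columns of the matrices \<open>P\<close>, placed in the blocks, form an eigenbasis of \<open>T\<^sub>N\<close>
  (\<open>trunc_eigenspace_block_heads\<close>). Uniqueness of the limiting distribution follows by testing
  with the functions \<open>x \<mapsto> e\<^sup>i\<^sup>t\<^sup>x\<close>, that is, from Levy's uniqueness theorem.\<close>

section \<open>Vectors and bounded operators on the Fock space\<close>

lemma fock_eqI: "(\<And>w. coefficient x w = coefficient y w) \<Longrightarrow> x = y"
  by (metis coefficient_inject ext)

lemma coefficient_simps [simp]:
  "coefficient 0 w = 0"
  "coefficient (x + y) w = coefficient x w + coefficient y w"
  "coefficient (x - y) w = coefficient x w - coefficient y w"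
  "coefficient (- x) w = - coefficient x w"
  "coefficient (c *\<^sub>C x) w = c * coefficient x w"
  by (transfer; simp)+

lemma coefficient_sum: "coefficient (\<Sum>i\<in>I. x i) w = (\<Sum>i\<in>I. coefficient (x i) w)"
  by (induction I rule: infinite_finite_induct) auto

lemma coefficient_\<xi>: "coefficient (\<xi> u) w = of_bool (w = u)"
  by transfer simp

lemma summable_coefficient: "(\<lambda>w. (cmod (coefficient x w))\<^sup>2) summable_on UNIV"
  using coefficient[of x] by (simp add: square_summable_def)

lemma cinner_commute: "cinner y x = cnj (cinner x y)"
  by transfer (simp flip: infsum_cnj add: mult.commute)

lemma cinner_add_left: "cinner (x + y) z = cinner x z + cinner y z"
  by transfer (simp add: distrib_right infsum_add square_summable_mult)

lemma cinner_scaleC_left: "cinner (c *\<^sub>C x) y = c * cinner x y"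
  by transfer (simp add: mult.assoc infsum_cmult_right')

lemma cinner_zero_left [simp]: "cinner 0 y = 0"
  by transfer simp

lemma cinner_diff_left: "cinner (x - y) z = cinner x z - cinner y z"
  using cinner_add_left[of "x - y" y z] by simp

lemma cinner_sum_left: "cinner (\<Sum>i\<in>I. x i) z = (\<Sum>i\<in>I. cinner (x i) z)"
  by (induction I rule: infinite_finite_induct) (auto simp: cinner_add_left)

lemma cinner_add_right: "cinner z (x + y) = cinner z x + cinner z y"
  by (metis cinner_add_left cinner_commute complex_cnj_add)

lemma cinner_diff_right: "cinner z (x - y) = cinner z x - cinner z y"
  by (metis cinner_diff_left cinner_commute complex_cnj_diff)

lemma cinner_scaleC_right: "cinner x (c *\<^sub>C y) = cnj c * cinner x y"
  by (metis cinner_scaleC_left cinner_commute complex_cnj_mult)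

lemma cinner_sum_right: "cinner z (\<Sum>i\<in>I. x i) = (\<Sum>i\<in>I. cinner z (x i))"
  by (induction I rule: infinite_finite_induct)
    (auto simp: cinner_add_right cinner_commute[of z 0])

lemma cinner_\<xi>_left: "cinner (\<xi> w) x = cnj (coefficient x w)"
  by (metis cinner_commute coefficient_eq_cinner)

lemma cinner_eqI: "(\<And>y. cinner x y = cinner x' y) \<Longrightarrow> x = x'"
  by (rule fock_eqI) (simp add: coefficient_eq_cinner)

lemma cinner_self: "cinner x x = complex_of_real ((norm x)\<^sup>2)"
proof (rule complex_eqI)
  show "Re (cinner x x) = Re (complex_of_real ((norm x)\<^sup>2))"
    using power2_norm_eq_inner[of x] by (simp add: inner_fock_def)
  show "Im (cinner x x) = Im (complex_of_real ((norm x)\<^sup>2))"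
    using arg_cong[OF cinner_commute[of x x], of Im] by simp
qed

lemma norm_fock_square: "(norm x)\<^sup>2 = (\<Sum>\<^sub>\<infinity>w. (cmod (coefficient x w))\<^sup>2)"
proof -
  have "((\<lambda>w. (cmod (coefficient x w))\<^sup>2) has_sum (\<Sum>\<^sub>\<infinity>w. (cmod (coefficient x w))\<^sup>2)) UNIV"
    by (rule has_sum_infsum[OF summable_coefficient])
  from has_sum_of_real[OF this, where ?'a = complex]
  have "cinner x x = complex_of_real (\<Sum>\<^sub>\<infinity>w. (cmod (coefficient x w))\<^sup>2)"
    unfolding cinner.rep_eq by (intro infsumI) (simp only: complex_norm_square)
  then show ?thesis
    by (metis cinner_self of_real_eq_iff)
qed

lemma norm_scaleC: "norm (c *\<^sub>C x) = cmod c * norm x"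
proof -
  have "complex_of_real ((norm (c *\<^sub>C x))\<^sup>2) = complex_of_real ((cmod c * norm x)\<^sup>2)"
    by (simp add: cinner_self[symmetric] cinner_scaleC_left cinner_scaleC_right power_mult_distrib
        complex_norm_square mult_ac del: of_real_power)
  then show ?thesis
    by (metis mult_nonneg_nonneg norm_ge_zero of_real_eq_iff power2_eq_iff_nonneg)
qed

lemma sum_coefficient_le_norm:
  "finite W \<Longrightarrow> (\<Sum>w\<in>W. (cmod (coefficient x w))\<^sup>2) \<le> (norm x)\<^sup>2"
  unfolding norm_fock_square
  by (rule finite_sum_le_infsum) (auto simp: summable_coefficient)

lemma norm_fock_leI:
  assumes "0 \<le> B" and "\<And>W. finite W \<Longrightarrow> (\<Sum>w\<in>W. (cmod (coefficient x w))\<^sup>2) \<le> B\<^sup>2"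
  shows "norm x \<le> B"
proof -
  have "(norm x)\<^sup>2 \<le> B\<^sup>2"
    unfolding norm_fock_square
    by (rule infsum_le_finite_sums) (auto simp: summable_coefficient assms(2))
  then show ?thesis
    using assms(1) power2_le_imp_le by blast
qed

lemma square_summableI:
  assumes "\<And>W. finite W \<Longrightarrow> (\<Sum>w\<in>W. (cmod (x w))\<^sup>2) \<le> B"
  shows "square_summable x"
  unfolding square_summable_def
  by (rule nonneg_bdd_above_summable_on) (use assms in \<open>auto simp: bdd_above_def\<close>)

lemma norm_cinner_le: "cmod (cinner x y) \<le> norm x * norm y"
proof -
  \<comment> \<open>A unimodular factor that turns \<open>\<langle>x, y\<rangle>\<close> into its modulus, so that the real
    Cauchy-Schwarz inequality applies.\<close>
  define c where "c = (if cinner x y = 0 then 1 else cnj (cinner x y) / cmod (cinner x y))"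
  have c: "cmod c = 1"
    by (simp add: c_def norm_divide)
  have "c * cinner x y = cmod (cinner x y)"
    by (auto simp: c_def complex_norm_square[symmetric] power2_eq_square field_simps)
  then have "cmod (cinner x y) = inner (c *\<^sub>C x) y"
    by (simp add: inner_fock_def cinner_scaleC_left)
  also have "\<dots> \<le> norm (c *\<^sub>C x) * norm y"
    by (rule norm_cauchy_schwarz)
  finally show ?thesis
    by (simp add: norm_scaleC c)
qed

lemma bounded_clinearI:
  assumes "\<And>x y. A (x + y) = A x + A y" "\<And>c x. A (c *\<^sub>C x) = c *\<^sub>C A x"
    "\<And>x. norm (A x) \<le> B * norm x"
  shows "bounded_clinear A"
  unfolding bounded_clinear_def
  by (intro conjI bounded_linear_intro[where K = B])
    (use assms in \<open>auto simp: scaleR_fock_def mult.commute\<close>)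

lemma bounded_clinearD:
  assumes "bounded_clinear A"
  shows "bounded_linear A" "A (x + y) = A x + A y" "A (x - y) = A x - A y"
    "A (c *\<^sub>C x) = c *\<^sub>C A x" "A 0 = 0" "A (sum g I) = (\<Sum>i\<in>I. A (g i))"
  using assms unfolding bounded_clinear_def
  by (auto simp: bounded_linear.linear linear_add linear_diff linear_sum linear_0)

text \<open>By Pythagoras, the squared distance from \<open>x\<close> to its restriction to a finite set \<open>W\<close> of words
  is \<open>\<parallel>x\<parallel>\<^sup>2 - \<Sum>\<^sub>W |x\<^sub>w|\<^sup>2\<close>, which tends to zero. This lets identities between bounded operators be
  checked on basis vectors.\<close>

lemma finite_expansion_tendsto:
  "((\<lambda>W. \<Sum>w\<in>W. coefficient x w *\<^sub>C \<xi> w) \<longlongrightarrow> x) (finite_subsets_at_top UNIV)"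
proof -
  let ?S = "\<lambda>W. \<Sum>w\<in>W. coefficient x w *\<^sub>C \<xi> w"
  have eq: "(norm (x - ?S W))\<^sup>2 = (norm x)\<^sup>2 - (\<Sum>w\<in>W. (cmod (coefficient x w))\<^sup>2)"
    if "finite W" for W
  proof -
    have "coefficient (?S W) w = (if w \<in> W then coefficient x w else 0)" for w
      using that by (simp add: coefficient_sum coefficient_\<xi> of_bool_def if_distrib
          sum.delta cong: if_cong)
    then have "cinner (x - ?S W) (?S W) = 0"
      by (simp add: cinner_sum_right cinner_scaleC_right coefficient_eq_cinner[symmetric])
    moreover have "cinner (?S W) x = (\<Sum>w\<in>W. complex_of_real ((cmod (coefficient x w))\<^sup>2))"
      by (simp add: cinner_sum_left cinner_scaleC_left cinner_\<xi>_left complex_norm_square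
          del: of_real_power)
    moreover have "cinner (x - ?S W) (x - ?S W) = cinner (x - ?S W) x - cinner (x - ?S W) (?S W)"
      by (rule cinner_diff_right)
    ultimately have "complex_of_real ((norm (x - ?S W))\<^sup>2)
        = complex_of_real ((norm x)\<^sup>2 - (\<Sum>w\<in>W. (cmod (coefficient x w))\<^sup>2))"
      unfolding cinner_self[symmetric] of_real_diff
      by (simp add: cinner_diff_left del: of_real_power)
    then show ?thesis
      by (simp only: of_real_eq_iff)
  qed
  have "((\<lambda>W. \<Sum>w\<in>W. (cmod (coefficient x w))\<^sup>2) \<longlongrightarrow> (norm x)\<^sup>2) (finite_subsets_at_top UNIV)"
    unfolding norm_fock_square
    using has_sum_infsum[OF summable_coefficient] by (simp add: has_sum_def)
  from tendsto_real_sqrt[OF tendsto_diff[OF tendsto_const[of "(norm x)\<^sup>2"] this]]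
  have "((\<lambda>W. sqrt ((norm x)\<^sup>2 - (\<Sum>w\<in>W. (cmod (coefficient x w))\<^sup>2))) \<longlongrightarrow> 0)
      (finite_subsets_at_top UNIV)"
    by simp
  then have "((\<lambda>W. norm (x - ?S W)) \<longlongrightarrow> 0) (finite_subsets_at_top UNIV)"
  proof (rule Lim_transform_eventually)
    show "\<forall>\<^sub>F W in finite_subsets_at_top UNIV.
        sqrt ((norm x)\<^sup>2 - (\<Sum>w\<in>W. (cmod (coefficient x w))\<^sup>2)) = norm (x - ?S W)"
      by (rule eventually_finite_subsets_at_top_weakI) (simp add: eq[symmetric])
  qed
  then show ?thesis
    by (subst tendsto_dist_iff) (simp add: dist_norm norm_minus_commute)
qed

lemma power2_le_mult_imp_le: "s\<^sup>2 \<le> b * s \<Longrightarrow> 0 \<le> s \<Longrightarrow> 0 \<le> b \<Longrightarrow> s \<le> (b :: real)"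
  by (cases "s = 0") (use mult_right_le_imp_le[of s s b] in \<open>simp_all add: power2_eq_square\<close>)

text \<open>The coefficients of the adjoint must be \<open>\<langle>y, A \<xi>\<^sub>w\<rangle>\<close>. For square-summability take a finite
  set \<open>W\<close> of words and let \<open>z = \<Sum>\<^sub>W \<langle>y, A \<xi>\<^sub>w\<rangle> \<xi>\<^sub>w\<close>; then \<open>\<parallel>z\<parallel>\<^sup>2 = \<langle>y, A z\<rangle> \<le> \<parallel>y\<parallel> \<parallel>A\<parallel> \<parallel>z\<parallel>\<close>, so
  \<open>\<parallel>z\<parallel> \<le> \<parallel>y\<parallel> \<parallel>A\<parallel>\<close> uniformly in \<open>W\<close>.\<close>

lemma adjoint_exists:
  assumes A: "bounded_clinear A"
  shows "\<exists>B. \<forall>x y. cinner (A x) y = cinner x (B y)"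
proof -
  have summable: "square_summable (\<lambda>w. cinner y (A (\<xi> w)))" for y
  proof (rule square_summableI)
    fix W :: "'a list set"
    assume W: "finite W"
    let ?z = "\<Sum>w\<in>W. cinner y (A (\<xi> w)) *\<^sub>C \<xi> w"
    let ?s = "\<Sum>w\<in>W. (cmod (cinner y (A (\<xi> w))))\<^sup>2"
    have "coefficient ?z w = (if w \<in> W then cinner y (A (\<xi> w)) else 0)" for w
      using W by (simp add: coefficient_sum coefficient_\<xi> of_bool_def if_distrib
          sum.delta cong: if_cong)
    then have "cinner ?z ?z = complex_of_real ?s"
      by (simp add: cinner_sum_right cinner_scaleC_right coefficient_eq_cinner[symmetric]
          complex_norm_square mult.commute del: of_real_power)
    then have z: "(norm ?z)\<^sup>2 = ?s"
      unfolding cinner_self by (simp only: of_real_eq_iff)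
    have "cinner y (A ?z) = complex_of_real ?s"
      by (simp add: bounded_clinearD[OF A] cinner_sum_right cinner_scaleC_right
          complex_norm_square mult.commute del: of_real_power)
    then have "?s = cmod (cinner y (A ?z))"
      by (simp add: sum_nonneg del: of_real_sum)
    also have "\<dots> \<le> norm y * norm (A ?z)"
      by (rule norm_cinner_le)
    also have "\<dots> \<le> norm y * (onorm A * norm ?z)"
      by (intro mult_left_mono onorm bounded_clinearD[OF A]) simp
    finally have *: "(norm ?z)\<^sup>2 \<le> (norm y * onorm A) * norm ?z"
      by (simp add: z mult.assoc)
    have nn: "0 \<le> norm y * onorm A"
      by (simp add: onorm_pos_le bounded_clinearD[OF A])
    have "norm ?z \<le> norm y * onorm A"
      using power2_le_mult_imp_le[OF * norm_ge_zero nn] .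
    then show "?s \<le> (norm y * onorm A)\<^sup>2"
      unfolding z[symmetric] by (rule power_mono) simp
  qed
  define B where "B = (\<lambda>y. Abs_fock (\<lambda>w. cinner y (A (\<xi> w))))"
  have coeff: "coefficient (B y) w = cinner y (A (\<xi> w))" for y w
    unfolding B_def using summable by (subst Abs_fock_inverse) auto
  have "cinner (A x) y = cinner x (B y)" for x y
  proof -
    let ?S = "\<lambda>W. \<Sum>w\<in>W. coefficient x w *\<^sub>C \<xi> w"
    have *: "cinner (A (?S W)) y = cinner (?S W) (B y)" for W
      by (simp add: bounded_clinearD[OF A] cinner_sum_left cinner_scaleC_left cinner_\<xi>_left coeff
          cinner_commute[of y])
    have lim: "((\<lambda>W. cinner (C (?S W)) z) \<longlongrightarrow> cinner (C x) z) (finite_subsets_at_top UNIV)"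
      if "bounded_linear C" for C :: "'a fock \<Rightarrow> 'a fock" and z
    proof -
      have "bounded_linear (\<lambda>x. cinner x z)"
        by (rule bounded_linear_intro[where K = "norm z"])
          (auto simp: cinner_add_left scaleR_fock_def cinner_scaleC_left scaleR_conv_of_real
            norm_cinner_le)
      from bounded_linear.tendsto[OF this bounded_linear.tendsto[OF that finite_expansion_tendsto]]
      show ?thesis .
    qed
    show ?thesis
      using lim[OF bounded_clinearD(1)[OF A], of y] lim[OF bounded_linear_ident, of "B y"]
      unfolding * by (intro tendsto_unique[OF _ _ ]) auto
  qed
  then show ?thesis
    by blast
qed

lemma cinner_adj:
  assumes "bounded_clinear A"
  shows "cinner (A x) y = cinner x (adj A y)"
proof -
  have "\<exists>!B. \<forall>x y. cinner (A x) y = cinner x (B y)"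
  proof (rule ex_ex1I[OF adjoint_exists[OF assms]])
    fix B B'
    assume *: "\<forall>x y. cinner (A x) y = cinner x (B y)" "\<forall>x y. cinner (A x) y = cinner x (B' y)"
    show "B = B'"
    proof
      fix y
      show "B y = B' y"
        using * by (intro cinner_eqI) (metis cinner_commute)
    qed
  qed
  from theI'[OF this] show ?thesis
    unfolding adj_def by blast
qed

lemma bounded_clinear_adj:
  assumes A: "bounded_clinear A"
  shows "bounded_clinear (adj A)"
proof (rule bounded_clinearI)
  note adj = cinner_adj[OF A, symmetric]
  have adj': "cinner (adj A y) x = cinner y (A x)" for x y
    by (metis adj cinner_commute)
  show "adj A (x + y) = adj A x + adj A y" for x y
    by (rule cinner_eqI) (simp add: adj' cinner_add_left)
  show "adj A (c *\<^sub>C x) = c *\<^sub>C adj A x" for c x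
    by (rule cinner_eqI) (simp add: adj' cinner_scaleC_left)
  show "norm (adj A x) \<le> onorm A * norm x" for x
  proof -
    have "(norm (adj A x))\<^sup>2 = cmod (cinner (adj A x) (adj A x))"
      by (simp add: cinner_self norm_power)
    also have "\<dots> = cmod (cinner x (A (adj A x)))"
      by (simp add: adj')
    also have "\<dots> \<le> norm x * norm (A (adj A x))"
      by (rule norm_cinner_le)
    also have "\<dots> \<le> norm x * (onorm A * norm (adj A x))"
      by (intro mult_left_mono onorm bounded_clinearD[OF A]) simp
    finally have "(norm (adj A x))\<^sup>2 \<le> (onorm A * norm x) * norm (adj A x)"
      by (simp add: mult_ac)
    then show ?thesis
      using onorm_pos_le[OF bounded_clinearD(1)[OF A]] by (rule_tac power2_le_mult_imp_le) auto
  qed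
qed

section \<open>Fourier series of functions on the circle\<close>

lemma has_integral_cis:
  "((\<lambda>t. cis (of_int j * t)) has_integral (if j = 0 then 2 * pi else 0)) {0..2 * pi}"
proof (cases "j = 0")
  case True
  then show ?thesis
    using has_integral_const_real[of "1 :: complex" 0 "2 * pi"] by (simp add: scaleR_conv_of_real)
next
  case False
  have "((\<lambda>t. cis (of_int j * t)) has_integral
      (cis (of_int j * (2 * pi)) / (\<i> * of_int j) - cis (of_int j * 0) / (\<i> * of_int j))) {0..2 * pi}"
  proof (rule fundamental_theorem_of_calculus)
    show "((\<lambda>t. cis (of_int j * t) / (\<i> * of_int j)) has_vector_derivative cis (of_int j * t))
        (at t within {0..2 * pi})" for t
    proof -
      have "((\<lambda>z. exp (\<i> * (of_int j * z)) / (\<i> * of_int j)) has_field_derivative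
          exp (\<i> * (of_int j * complex_of_real t))) (at (complex_of_real t))"
        by (rule derivative_eq_intros refl | use False in \<open>simp add: field_simps\<close>)+
      from has_vector_derivative_real_field[OF this] show ?thesis
        by (simp add: cis_conv_exp)
    qed
  qed simp
  moreover have "cis (of_int j * (2 * pi)) = 1"
    using cis_multiple_2pi[of "of_int j"] by (simp add: mult_ac)
  ultimately show ?thesis
    using False by simp
qed

lemma has_integral_fourier_coeff:
  assumes "continuous_on (sphere 0 1) f"
  shows "((\<lambda>t. f (cis t) * cis (- of_int j * t))
      has_integral complex_of_real (2 * pi) * fourier_coeff f j) {0..2 * pi}"
proof -
  have "continuous_on {0..2 * pi} (\<lambda>t. f (cis t) * cis (- of_int j * t))"
    by (intro continuous_intros continuous_on_compose2[OF assms]) auto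
  from integrable_integral[OF integrable_continuous_interval[OF this]]
  show ?thesis
    by (simp add: fourier_coeff_def)
qed

lemma fourier_coeffI:
  "((\<lambda>t. f (cis t) * cis (- of_int j * t)) has_integral complex_of_real (2 * pi) * c) {0..2 * pi}
    \<Longrightarrow> fourier_coeff f j = c"
  unfolding fourier_coeff_def by (simp add: integral_unique)

lemma fourier_coeff_poly: "fourier_coeff (poly p) (int j) = coeff p j"
proof (rule fourier_coeffI)
  have "((\<lambda>t. \<Sum>i\<le>degree p. coeff p i * cis (of_int (int i - int j) * t)) has_integral
      (\<Sum>i\<le>degree p. coeff p i * (if int i - int j = 0 then 2 * pi else 0))) {0..2 * pi}"
    by (intro has_integral_sum has_integral_mult_right has_integral_cis) simp
  also have "(\<Sum>i\<le>degree p. coeff p i * (if int i - int j = 0 then 2 * pi else 0))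
      = (\<Sum>i\<le>degree p. if i = j then coeff p i * (2 * pi) else 0)"
    by (intro sum.cong) auto
  also have "\<dots> = complex_of_real (2 * pi) * coeff p j"
    by (simp add: sum.delta coeff_eq_0)
  also have "(\<lambda>t. \<Sum>i\<le>degree p. coeff p i * cis (of_int (int i - int j) * t))
      = (\<lambda>t. poly p (cis t) * cis (- of_int (int j) * t))"
  proof
    fix t
    have "cis (of_int (int i - int j) * t) = cis t ^ i * cis (- of_int (int j) * t)" for i
      unfolding Complex.DeMoivre cis_mult by (simp add: algebra_simps)
    then show "(\<Sum>i\<le>degree p. coeff p i * cis (of_int (int i - int j) * t))
        = poly p (cis t) * cis (- of_int (int j) * t)"
      by (simp add: poly_altdef sum_distrib_right mult.assoc)
  qed
  finally show "((\<lambda>t. poly p (cis t) * cis (- of_int (int j) * t))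
      has_integral complex_of_real (2 * pi) * coeff p j)
      {0..2 * pi}" .
qed

text \<open>Fourier coefficients are continuous in the uniform norm, and those of a polynomial with
  nonnegative index are its coefficients.\<close>

lemma coeff_tendsto_fourier_coeff:
  assumes f: "continuous_on (sphere 0 1) f"
    and p: "uniform_limit (sphere 0 1) (\<lambda>n. poly (p n)) f sequentially"
  shows "(\<lambda>n. coeff (p n) j) \<longlonglongrightarrow> fourier_coeff f (int j)"
proof (rule tendstoI)
  fix e :: real
  assume e: "e > 0"
  have "\<forall>\<^sub>F n in sequentially. \<forall>z\<in>sphere 0 1. dist (poly (p n) z) (f z) < e / 2"
    using uniform_limitD[OF p, of "e / 2"] e by simp
  then show "\<forall>\<^sub>F n in sequentially. dist (coeff (p n) j) (fourier_coeff f (int j)) < e"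
  proof eventually_elim
    case (elim n)
    have "((\<lambda>t. poly (p n) (cis t) * cis (- of_int (int j) * t) - f (cis t) * cis (- of_int (int j) * t))
        has_integral complex_of_real (2 * pi) * fourier_coeff (poly (p n)) (int j)
            - complex_of_real (2 * pi) * fourier_coeff f (int j))
        {0..2 * pi}"
      by (intro has_integral_diff has_integral_fourier_coeff f continuous_intros)
    then have "norm (complex_of_real (2 * pi) * fourier_coeff (poly (p n)) (int j)
        - complex_of_real (2 * pi) * fourier_coeff f (int j))
        \<le> e / 2 * measure lborel {0..2 * pi}"
    proof (rule has_integral_bound_real[rotated 2])
      fix t :: real
      have "norm (poly (p n) (cis t) * cis (- of_int (int j) * t) - f (cis t)
          * cis (- of_int (int j) * t))
          = dist (poly (p n) (cis t)) (f (cis t))"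
        unfolding left_diff_distrib[symmetric] by (simp add: norm_mult dist_norm)
      then show "norm (poly (p n) (cis t) * cis (- of_int (int j) * t) - f (cis t)
          * cis (- of_int (int j) * t)) \<le> e / 2"
        using elim by (simp add: less_imp_le)
    qed (use e in auto)
    also have "complex_of_real (2 * pi) * fourier_coeff (poly (p n)) (int j) - complex_of_real (2
        * pi) * fourier_coeff f (int j)
        = complex_of_real (2 * pi) * (coeff (p n) j - fourier_coeff f (int j))"
      by (simp add: fourier_coeff_poly algebra_simps)
    finally have "2 * pi * dist (coeff (p n) j) (fourier_coeff f (int j)) \<le> 2 * pi * (e / 2)"
      by (simp add: norm_mult dist_norm)
    then show ?case
      using e by simp
  qed
qed

subsection \<open>Fejer means\<close>

text \<open>The mean over \<open>k < n\<close> of the partial sums \<open>\<Sum>\<^sub>l\<^sub>\<le>\<^sub>k c\<^sub>k\<^sub>-\<^sub>l z\<^sup>k\<^sup>-\<^sup>l\<close>. For an analytic \<open>f\<close> this is the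
  \<open>n\<close>-th Fejer mean of its Fourier series.\<close>

definition fejer_poly :: "(complex \<Rightarrow> complex) \<Rightarrow> nat \<Rightarrow> complex poly" where
  "fejer_poly f n = (\<Sum>k<n. \<Sum>l\<le>k. monom (fourier_coeff f (int k - int l) / of_nat n) (k - l))"

definition fejer_kernel :: "nat \<Rightarrow> real \<Rightarrow> real" where
  "fejer_kernel n u = (cmod (\<Sum>k<n. cis (real k * u)))\<^sup>2 / real n"

lemma fejer_kernel_expand:
  "complex_of_real (fejer_kernel n u)
    = (\<Sum>k<n. \<Sum>l<n. cis (of_int (int k - int l) * u)) / of_nat n"
proof -
  have "complex_of_real ((cmod (\<Sum>k<n. cis (real k * u)))\<^sup>2)
      = (\<Sum>k<n. \<Sum>l<n. cis (real k * u) * cnj (cis (real l * u)))"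
    unfolding complex_norm_square by (simp add: sum_product)
  also have "\<dots> = (\<Sum>k<n. \<Sum>l<n. cis (of_int (int k - int l) * u))"
    by (simp add: cis_cnj cis_mult algebra_simps)
  finally show ?thesis
    by (simp add: fejer_kernel_def)
qed

text \<open>Expanding the kernel into \<open>\<Sum>\<^sub>k\<^sub>,\<^sub>l e\<^sup>i\<^sup>(\<^sup>k\<^sup>-\<^sup>l\<^sup>)\<^sup>u\<close> gives all frequencies \<open>k - l\<close>; those with \<open>l > k\<close>
  are multiplied by vanishing Fourier coefficients, so a polynomial in \<open>z\<close> remains.\<close>

lemma has_integral_fejer:
  assumes f: "continuous_on (sphere 0 1) f" and analytic: "\<forall>j<0. fourier_coeff f j = 0"
  shows "((\<lambda>t. f (cis t) * fejer_kernel n (s - t))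
      has_integral complex_of_real (2 * pi) * poly (fejer_poly f n) (cis s))
    {0..2 * pi}"
proof -
  have "((\<lambda>t. \<Sum>k<n. \<Sum>l<n. cis (of_int (int k - int l) * s) / of_nat n *
        (f (cis t) * cis (- of_int (int k - int l) * t)))
      has_integral (\<Sum>k<n. \<Sum>l<n. cis (of_int (int k - int l) * s) / of_nat n *
        (complex_of_real (2 * pi) * fourier_coeff f (int k - int l)))) {0..2 * pi}"
    by (intro has_integral_sum has_integral_mult_right has_integral_fourier_coeff f finite_lessThan)
  also have "(\<lambda>t. \<Sum>k<n. \<Sum>l<n. cis (of_int (int k - int l) * s) / of_nat n *
        (f (cis t) * cis (- of_int (int k - int l) * t))) = (\<lambda>t. f (cis t) * fejer_kernel n (s - t))"
  proof
    fix t
    have "cis (of_int (int k - int l) * s) / of_nat n * (f (cis t) * cis (- of_int (int k - int l) * t))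
        = f (cis t) * cis (of_int (int k - int l) * (s - t)) / of_nat n" for k l
    proof -
      have "cis (of_int (int k - int l) * (s - t))
          = cis (of_int (int k - int l) * s) * cis (- of_int (int k - int l) * t)"
        by (simp add: cis_mult algebra_simps)
      then show ?thesis
        by (simp only: times_divide_eq_left times_divide_eq_right mult_ac)
    qed
    then show "(\<Sum>k<n. \<Sum>l<n. cis (of_int (int k - int l) * s) / of_nat n *
        (f (cis t) * cis (- of_int (int k - int l) * t))) = f (cis t) * fejer_kernel n (s - t)"
      by (simp only: fejer_kernel_expand sum_distrib_left sum_divide_distrib times_divide_eq_right)
  qed
  also have "(\<Sum>k<n. \<Sum>l<n. cis (of_int (int k - int l) * s) / of_nat n *
        (complex_of_real (2 * pi) * fourier_coeff f (int k - int l)))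
      = (\<Sum>k<n. \<Sum>l\<le>k. cis (of_int (int k - int l) * s) / of_nat n *
        (complex_of_real (2 * pi) * fourier_coeff f (int k - int l)))"
    by (intro sum.cong sum.mono_neutral_right) (use analytic in auto)
  also have "\<dots> = complex_of_real (2 * pi) * poly (fejer_poly f n) (cis s)"
    by (simp add: fejer_poly_def poly_sum poly_monom Complex.DeMoivre sum_distrib_left of_nat_diff
        mult_ac)
  finally show ?thesis .
qed

lemma has_integral_fejer_kernel:
  assumes "n > 0"
  shows "((\<lambda>t. fejer_kernel n (s - t)) has_integral 2 * pi) {0..2 * pi}"
proof -
  \<comment> \<open>The total mass is the Fejer mean of the constant function \<open>1\<close>.\<close>
  have coeff: "fourier_coeff (\<lambda>_. 1) j = of_bool (j = 0)" for j
    using has_integral_cis[of "- j"] by (intro fourier_coeffI) (cases "j = 0"; simp)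
  have "(\<Sum>l\<le>k. poly (monom (of_bool (int k - int l = 0) / of_nat n) (k - l)) (cis s))
      = (\<Sum>l\<le>k. if l = k then 1 / of_nat n else 0)" for k
    by (intro sum.cong) (auto simp: poly_monom)
  then have "poly (fejer_poly (\<lambda>_. 1) n) (cis s) = 1"
    using assms by (simp add: fejer_poly_def poly_sum coeff)
  moreover have "\<forall>j<0. fourier_coeff (\<lambda>_. 1) j = 0"
    by (simp add: coeff)
  ultimately have "((\<lambda>t. complex_of_real (fejer_kernel n (s - t))) has_integral 2 * pi) {0..2 * pi}"
    using has_integral_fejer[of "\<lambda>_. 1" n s] by simp
  from has_integral_linear[OF this bounded_linear_Re] show ?thesis
    by (simp add: o_def)
qed

text \<open>The factor \<open>|e\<^sup>i\<^sup>u - 1|\<^sup>2\<close> cancels the denominator of the geometric sum in the kernel, leaving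
  \<open>|e\<^sup>i\<^sup>n\<^sup>u - 1|\<^sup>2 / n\<close>. So the kernel has a second moment of order \<open>1/n\<close> about its centre.\<close>

lemma fejer_kernel_dist: "fejer_kernel n (s - t) * (dist (cis s) (cis t))\<^sup>2 \<le> 4 / real n"
proof -
  have "cis s - cis t = cis t * (cis (s - t) - 1)"
    by (simp add: algebra_simps cis_mult)
  then have d: "dist (cis s) (cis t) = cmod (1 - cis (s - t))"
    by (simp add: dist_norm norm_mult norm_minus_commute)
  have "(1 - cis (s - t)) * (\<Sum>k<n. cis (real k * (s - t))) = 1 - cis (s - t) ^ n"
    by (simp only: one_diff_power_eq Complex.DeMoivre[symmetric])
  then have "cmod (1 - cis (s - t)) * cmod (\<Sum>k<n. cis (real k * (s - t))) = cmod (1 - cis (s - t) ^ n)"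
    by (metis norm_mult)
  also have "\<dots> \<le> 2"
    using norm_triangle_ineq4[of 1 "cis (s - t) ^ n"] by (simp add: norm_power)
  finally have "(cmod (1 - cis (s - t)) * cmod (\<Sum>k<n. cis (real k * (s - t))))\<^sup>2 \<le> 2\<^sup>2"
    by (intro power_mono) auto
  then show ?thesis
    unfolding d fejer_kernel_def by (simp add: power_mult_distrib mult.commute divide_right_mono)
qed

text \<open>Korovkin's argument: uniform continuity and boundedness give \<open>|f w - f z| \<le> \<epsilon> + C |z - w|\<^sup>2\<close>
  on the whole circle. Averaging this against the kernel, which is nonnegative with mean one and
  second moment at most \<open>4/n\<close>, bounds the error by \<open>\<epsilon> + 4 C / n\<close>.\<close>

lemma fejer_uniform_limit:
  assumes f: "continuous_on (sphere 0 1) f" and analytic: "\<forall>j<0. fourier_coeff f j = 0"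
  shows "uniform_limit (sphere 0 1) (\<lambda>n. poly (fejer_poly f n)) f sequentially"
proof (rule uniform_limitI)
  fix e :: real
  assume e: "e > 0"
  have "uniformly_continuous_on (sphere 0 1) f"
    using f by (rule compact_uniformly_continuous) simp
  then obtain \<delta> where \<delta>: "\<delta> > 0"
    "\<And>z w. z \<in> sphere 0 1 \<Longrightarrow> w \<in> sphere 0 1 \<Longrightarrow> dist w z < \<delta> \<Longrightarrow> dist (f w) (f z) < e / 2"
    unfolding uniformly_continuous_on_def using half_gt_zero[OF e] by meson
  have "compact (f ` sphere 0 1)"
    using f by (intro compact_continuous_image) auto
  then obtain M where M: "\<And>z. z \<in> sphere 0 1 \<Longrightarrow> norm (f z) \<le> M" "M > 0"
    using compact_imp_bounded bounded_pos by (metis (no_types, lifting) imageI)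
  define C where "C = 2 * M / \<delta>\<^sup>2"
  have C: "C > 0"
    using M \<delta> by (simp add: C_def)
  have fC: "dist (f w) (f z) \<le> e / 2 + C * (dist z w)\<^sup>2" if "z \<in> sphere 0 1" "w \<in> sphere 0 1" for z w
  proof (cases "dist z w < \<delta>")
    case True
    then have "dist (f w) (f z) < e / 2"
      using \<delta>(2) that by (simp add: dist_commute)
    then show ?thesis
      using C by (simp add: add_increasing2 less_imp_le)
  next
    case False
    then have "\<delta>\<^sup>2 \<le> (dist z w)\<^sup>2"
      using \<delta> by (intro power_mono) auto
    then have "2 * M \<le> C * (dist z w)\<^sup>2"
      unfolding C_def using \<delta> M by (simp add: field_simps)
    moreover have "dist (f w) (f z) \<le> 2 * M"
      using norm_triangle_ineq4[of "f w" "f z"] M(1)[OF that(1)] M(1)[OF that(2)]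
      by (simp add: dist_norm)
    ultimately show ?thesis
      using e by simp
  qed
  have "\<forall>\<^sub>F n in sequentially. 4 * C / real n < e / 2"
    using e by real_asymp
  then show "\<forall>\<^sub>F n in sequentially. \<forall>z\<in>sphere 0 1. dist (poly (fejer_poly f n) z) (f z) < e"
    using eventually_gt_at_top[of 0]
  proof eventually_elim
    case (elim n)
    show ?case
    proof
      fix z :: complex
      assume z: "z \<in> sphere 0 1"
      then obtain s where s: "z = cis s"
        using complex_norm_eq_1_exp[of z] by (metis cis_conv_exp dist_0_norm mem_sphere)
      let ?K = "\<lambda>t. fejer_kernel n (s - t)"
      have K: "?K t \<ge> 0" for t
        by (simp add: fejer_kernel_def)
      have "((\<lambda>t. of_real (?K t)) has_integral complex_of_real (2 * pi)) {0..2 * pi}"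
        using has_integral_linear[OF has_integral_fejer_kernel[of n s] bounded_linear_of_real] elim
        by (simp add: o_def)
      from has_integral_diff[OF has_integral_fejer[OF f analytic, of n s]
          has_integral_mult_right[OF this, of "f z"]]
      have I: "((\<lambda>t. (f (cis t) - f z) * ?K t)
          has_integral complex_of_real (2 * pi) * (poly (fejer_poly f n) z - f z))
          {0..2 * pi}"
        by (simp add: algebra_simps s)
      have J: "((\<lambda>t. e / 2 * ?K t + 4 * C / real n)
          has_integral e / 2 * (2 * pi) + 4 * C / real n * (2 * pi))
          {0..2 * pi}"
        using elim has_integral_const_real[of "4 * C / real n" 0 "2 * pi"]
        by (intro has_integral_add has_integral_mult_right has_integral_fejer_kernel)
          (simp_all add: mult.commute)
      have "norm (integral {0..2 * pi} (\<lambda>t. (f (cis t) - f z) * ?K t))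
          \<le> integral {0..2 * pi} (\<lambda>t. e / 2 * ?K t + 4 * C / real n)"
      proof (rule integral_norm_bound_integral)
        fix t :: real
        have "norm ((f (cis t) - f z) * ?K t) = dist (f (cis t)) (f z) * ?K t"
          using K by (simp add: norm_mult dist_norm)
        also have "\<dots> \<le> (e / 2 + C * (dist z (cis t))\<^sup>2) * ?K t"
          using z by (intro mult_right_mono fC K) auto
        also have "\<dots> = e / 2 * ?K t + C * (?K t * (dist (cis s) (cis t))\<^sup>2)"
          by (simp add: s algebra_simps)
        also have "\<dots> \<le> e / 2 * ?K t + C * (4 / real n)"
          using C by (intro add_left_mono mult_left_mono fejer_kernel_dist) auto
        finally show "norm ((f (cis t) - f z) * ?K t) \<le> e / 2 * ?K t + 4 * C / real n"
          by (simp add: mult_ac)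
      qed (use I J in \<open>auto simp: has_integral_integrable\<close>)
      then have "2 * pi * dist (poly (fejer_poly f n) z) (f z) \<le> 2 * pi * (e / 2 + 4 * C / real n)"
        unfolding integral_unique[OF I] integral_unique[OF J] norm_mult dist_norm
        by (simp add: algebra_simps)
      then have "dist (poly (fejer_poly f n) z) (f z) \<le> e / 2 + 4 * C / real n"
        by simp
      then show "dist (poly (fejer_poly f n) z) (f z) < e"
        using elim by simp
    qed
  qed
qed

section \<open>Operators given by power series in a left shift\<close>

text \<open>Convolution with \<open>c\<close>, restricted to finitely supported sequences and cut off at \<open>K\<close>, has
  norm at most \<open>B\<close>. Only finitely many \<open>c\<^sub>j\<close> occur for each \<open>K\<close>, which makes the property closed
  under pointwise limits of \<open>c\<close>.\<close>

definition convolution_bound :: "(nat \<Rightarrow> complex) \<Rightarrow> real \<Rightarrow> bool" where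
  "convolution_bound c B \<longleftrightarrow> 0 \<le> B \<and>
    (\<forall>y K. (\<Sum>k\<le>K. (cmod (\<Sum>j\<le>k. c j * y (k - j)))\<^sup>2) \<le> B\<^sup>2 * (\<Sum>k\<le>K. (cmod (y k))\<^sup>2))"

lemma convolution_boundD:
  "convolution_bound c B \<Longrightarrow> 0 \<le> B"
  "convolution_bound c B \<Longrightarrow>
    (\<Sum>k\<le>K. (cmod (\<Sum>j\<le>k. c j * y (k - j)))\<^sup>2) \<le> B\<^sup>2 * (\<Sum>k\<le>K. (cmod (y k))\<^sup>2)"
  by (simp_all add: convolution_bound_def)

lemma convolution_bound_minus: "convolution_bound (\<lambda>j. - c j) B \<longleftrightarrow> convolution_bound c B"
  by (simp add: convolution_bound_def sum_negf)

lemma convolution_bound_limit: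
  assumes c: "\<And>j. (\<lambda>n. c n j) \<longlonglongrightarrow> d j" and b: "b \<longlonglongrightarrow> B"
    and ev: "\<forall>\<^sub>F n in sequentially. convolution_bound (c n) (b n)"
  shows "convolution_bound d B"
  unfolding convolution_bound_def
proof (intro conjI allI)
  show "0 \<le> B"
    by (rule tendsto_lowerbound[OF b]) (use ev in \<open>auto simp: convolution_bound_def elim:
        eventually_mono\<close>)
  fix y :: "nat \<Rightarrow> complex" and K
  show "(\<Sum>k\<le>K. (cmod (\<Sum>j\<le>k. d j * y (k - j)))\<^sup>2) \<le> B\<^sup>2 * (\<Sum>k\<le>K. (cmod (y k))\<^sup>2)"
  proof (rule tendsto_le[OF sequentially_bot])
    show "(\<lambda>n. \<Sum>k\<le>K. (cmod (\<Sum>j\<le>k. c n j * y (k - j)))\<^sup>2) \<longlonglongrightarrow> (\<Sum>k\<le>K. (cmod (\<Sum>j\<le>k. d j * y (k - j)))\<^sup>2)"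
      by (intro tendsto_intros c)
    show "(\<lambda>n. (b n)\<^sup>2 * (\<Sum>k\<le>K. (cmod (y k))\<^sup>2)) \<longlonglongrightarrow> B\<^sup>2 * (\<Sum>k\<le>K. (cmod (y k))\<^sup>2)"
      by (intro tendsto_intros b)
    show "\<forall>\<^sub>F n in sequentially. (\<Sum>k\<le>K. (cmod (\<Sum>j\<le>k. c n j * y (k - j)))\<^sup>2)
        \<le> (b n)\<^sup>2 * (\<Sum>k\<le>K. (cmod (y k))\<^sup>2)"
      using ev by eventually_elim (simp add: convolution_bound_def)
  qed
qed

lemma has_integral_Parseval:
  assumes "degree p \<le> n"
  shows "((\<lambda>t. (cmod (poly p (cis t)))\<^sup>2) has_integral 2 * pi * (\<Sum>k\<le>n. (cmod (coeff p k))\<^sup>2))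
    {0..2 * pi}"
proof -
  have poly: "poly p z = (\<Sum>k\<le>n. coeff p k * z ^ k)" for z
    using arg_cong[OF poly_as_sum_of_monoms'[OF assms], of "\<lambda>q. poly q z"]
    by (simp add: poly_sum poly_monom)
  have "((\<lambda>t. \<Sum>k\<le>n. \<Sum>l\<le>n. coeff p k * cnj (coeff p l) * cis (of_int (int k - int l) * t)) has_integral
      (\<Sum>k\<le>n. \<Sum>l\<le>n. coeff p k * cnj (coeff p l) * (if int k - int l = 0 then 2 * pi else 0))) {0..2 * pi}"
    by (intro has_integral_sum has_integral_mult_right has_integral_cis finite_atMost)
  also have "(\<lambda>t. \<Sum>k\<le>n. \<Sum>l\<le>n. coeff p k * cnj (coeff p l) * cis (of_int (int k - int l) * t))
      = (\<lambda>t. complex_of_real ((cmod (poly p (cis t)))\<^sup>2))"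
  proof
    fix t
    have "cis (of_int (int k - int l) * t) = cis t ^ k * cnj (cis t ^ l)" for k l
      unfolding Complex.DeMoivre cis_cnj cis_mult by (simp add: algebra_simps)
    then show "(\<Sum>k\<le>n. \<Sum>l\<le>n. coeff p k * cnj (coeff p l) * cis (of_int (int k - int l) * t))
        = complex_of_real ((cmod (poly p (cis t)))\<^sup>2)"
      unfolding complex_norm_square poly by (simp add: sum_product mult_ac)
  qed
  also have "(\<Sum>k\<le>n. \<Sum>l\<le>n. coeff p k * cnj (coeff p l) * (if int k - int l = 0 then 2 * pi else 0))
      = (\<Sum>k\<le>n. \<Sum>l\<le>n. if k = l then complex_of_real (2 * pi * (cmod (coeff p k))\<^sup>2) else 0)"
    by (intro sum.cong) (auto simp: complex_norm_square simp del: of_real_power)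
  also have "\<dots> = complex_of_real (2 * pi * (\<Sum>k\<le>n. (cmod (coeff p k))\<^sup>2))"
    by (simp add: sum_distrib_left)
  finally have "((\<lambda>t. complex_of_real ((cmod (poly p (cis t)))\<^sup>2)) has_integral
      complex_of_real (2 * pi * (\<Sum>k\<le>n. (cmod (coeff p k))\<^sup>2))) {0..2 * pi}" .
  from has_integral_linear[OF this bounded_linear_Re] show ?thesis
    by (simp add: o_def)
qed

text \<open>Convolution by the coefficients of \<open>p\<close> multiplies polynomials by \<open>p\<close>. By Parseval's identity
  the norm of a finite sequence is the \<open>L\<^sup>2\<close> norm on the circle of its polynomial, which
  multiplication by \<open>p\<close> increases at most by the factor \<open>B\<close>; dropping the coefficients beyond \<open>K\<close>
  decreases it.\<close>

lemma convolution_bound_poly: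
  assumes "\<And>z. z \<in> sphere 0 1 \<Longrightarrow> cmod (poly p z) \<le> B"
  shows "convolution_bound (coeff p) B"
  unfolding convolution_bound_def
proof (intro conjI allI)
  show B: "0 \<le> B"
    using assms[of 1] norm_ge_zero order_trans by (metis mem_sphere_0 norm_one)
  fix y :: "nat \<Rightarrow> complex" and K
  define q where "q = (\<Sum>i\<le>K. monom (y i) i)"
  have coeff_q: "coeff q i = (if i \<le> K then y i else 0)" for i
    by (simp add: q_def coeff_sum)
  then have deg: "degree q \<le> K"
    by (intro degree_le) simp
  \<comment> \<open>Parseval's identity needs all coefficients of \<open>p * q\<close>, so the sum is first enlarged.\<close>
  define n where "n = max K (degree (p * q))"
  have "(\<Sum>k\<le>K. (cmod (\<Sum>j\<le>k. coeff p j * y (k - j)))\<^sup>2) = (\<Sum>k\<le>K. (cmod (coeff (p * q) k))\<^sup>2)"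
    by (intro sum.cong refl)
      (auto simp: coeff_mult coeff_q intro!: arg_cong[of _ _ "\<lambda>z.
          (cmod z)\<^sup>2"] arg_cong[of _ _ cmod] sum.cong)
  also have "\<dots> \<le> (\<Sum>k\<le>n. (cmod (coeff (p * q) k))\<^sup>2)"
    by (intro sum_mono2) (auto simp: n_def)
  finally have "2 * pi * (\<Sum>k\<le>K. (cmod (\<Sum>j\<le>k. coeff p j * y (k - j)))\<^sup>2)
      \<le> 2 * pi * (\<Sum>k\<le>n. (cmod (coeff (p * q) k))\<^sup>2)"
    by simp
  also have "\<dots> \<le> B\<^sup>2 * (2 * pi * (\<Sum>k\<le>K. (cmod (coeff q k))\<^sup>2))"
  proof (rule has_integral_le)
    show "((\<lambda>t. (cmod (poly (p * q) (cis t)))\<^sup>2) has_integral 2 * pi * (\<Sum>k\<le>n. (cmod (coeff (p * q) k))\<^sup>2))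
        {0..2 * pi}"
      by (rule has_integral_Parseval) (simp add: n_def)
    show "((\<lambda>t. B\<^sup>2 * (cmod (poly q (cis t)))\<^sup>2) has_integral B\<^sup>2 * (2 * pi * (\<Sum>k\<le>K. (cmod (coeff q k))\<^sup>2)))
        {0..2 * pi}"
      by (intro has_integral_mult_right has_integral_Parseval deg)
    show "(cmod (poly (p * q) (cis t)))\<^sup>2 \<le> B\<^sup>2 * (cmod (poly q (cis t)))\<^sup>2" for t
      using assms[of "cis t"] by (auto simp: norm_mult power_mult_distrib intro!: mult_right_mono
          power_mono)
  qed
  also have "(\<Sum>k\<le>K. (cmod (coeff q k))\<^sup>2) = (\<Sum>k\<le>K. (cmod (y k))\<^sup>2)"
    by (simp add: coeff_q)
  finally show "(\<Sum>k\<le>K. (cmod (\<Sum>j\<le>k. coeff p j * y (k - j)))\<^sup>2) \<le> B\<^sup>2 * (\<Sum>k\<le>K. (cmod (y k))\<^sup>2)"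
    by simp
qed

text \<open>Replace \<open>f\<close> by its Fejer means \<open>f\<^sub>n\<close>: then \<open>q - f\<^sub>n\<close> is a polynomial bounded by \<open>B + \<epsilon>\<close> for
  large \<open>n\<close>. Two limits, first in \<open>n\<close> and then in \<open>\<epsilon>\<close>, give the claim. With \<open>q = 0\<close> it bounds the
  operator \<open>f(L)\<close>, and with \<open>q = p\<^sub>n\<close> it estimates \<open>p\<^sub>n(L) - f(L)\<close>.\<close>

lemma convolution_bound_fourier:
  assumes f: "continuous_on (sphere 0 1) f" and analytic: "\<forall>j<0. fourier_coeff f j = 0"
    and B: "\<And>z. z \<in> sphere 0 1 \<Longrightarrow> cmod (poly q z - f z) \<le> B"
  shows "convolution_bound (\<lambda>j. coeff q j - fourier_coeff f (int j)) B"
proof -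
  note lim = fejer_uniform_limit[OF f analytic]
  have *: "convolution_bound (\<lambda>j. coeff q j - fourier_coeff f (int j)) (B + e)" if "e > 0" for e
  proof (rule convolution_bound_limit)
    show "(\<lambda>n. coeff (q - fejer_poly f n) j) \<longlonglongrightarrow> coeff q j - fourier_coeff f (int j)" for j
      unfolding coeff_diff by (intro tendsto_intros coeff_tendsto_fourier_coeff[OF f lim])
    show "\<forall>\<^sub>F n in sequentially. convolution_bound (coeff (q - fejer_poly f n)) (B + e)"
      using uniform_limitD[OF lim that]
    proof eventually_elim
      case (elim n)
      show ?case
      proof (rule convolution_bound_poly)
        fix z :: complex
        assume z: "z \<in> sphere 0 1"
        have "cmod (poly (q - fejer_poly f n) z)
            = cmod ((poly q z - f z) - (poly (fejer_poly f n) z - f z))"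
          by simp
        also have "\<dots> \<le> cmod (poly q z - f z) + cmod (poly (fejer_poly f n) z - f z)"
          by (rule norm_triangle_ineq4)
        also have "\<dots> \<le> B + e"
          using B[OF z] elim z by (intro add_mono) (auto simp: dist_norm less_imp_le)
        finally show "cmod (poly (q - fejer_poly f n) z) \<le> B + e" .
      qed
    qed
  qed simp
  show ?thesis
  proof (rule convolution_bound_limit)
    show "(\<lambda>n. B + 1 / real (Suc n)) \<longlonglongrightarrow> B"
      using tendsto_add[OF tendsto_const[of B] LIMSEQ_inverse_real_of_nat]
          by (simp add: inverse_eq_divide)
    show "\<forall>\<^sub>F n in sequentially. convolution_bound (\<lambda>j. coeff q j - fourier_coeff f (int j)) (B + 1
        / real (Suc n))"
      by (intro always_eventually allI *) simp
  qed simp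
qed

text \<open>The words at which the orbits of the left shift by \<open>a\<close> start: every word is obtained from
  exactly one of them by prepending copies of \<open>a\<close>.\<close>

definition unprefixed :: "'d \<Rightarrow> 'd list set" where
  "unprefixed a = {v. v = [] \<or> hd v \<noteq> a}"

lemma word_eq_replicate_append:
  "w = replicate (length (takeWhile ((=) a) w)) a @ dropWhile ((=) a) w"
  by (induction w) auto

lemma dropWhile_in_unprefixed: "dropWhile ((=) a) w \<in> unprefixed a"
  by (induction w) (auto simp: unprefixed_def)

lemma word_decomposition:
  obtains k v where "w = replicate k a @ v" "v \<in> unprefixed a"
  by (rule that[OF word_eq_replicate_append dropWhile_in_unprefixed])

lemma replicate_append_eq_iff:
  assumes "v \<in> unprefixed a" "v' \<in> unprefixed a"
  shows "replicate k a @ v = replicate l a @ v' \<longleftrightarrow> k = l \<and> v = v'"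
proof
  show "replicate k a @ v = replicate l a @ v' \<Longrightarrow> k = l \<and> v = v'"
  proof (induction k arbitrary: l)
    case 0
    then show ?case
      using assms by (cases l) (auto simp: unprefixed_def)
  next
    case (Suc k)
    then show ?case
      using assms by (cases l) (auto simp: unprefixed_def)
  qed
qed simp

lemma coefficient_left_shift:
  "coefficient (left_shift a x) w = (case w of [] \<Rightarrow> 0 | j # v \<Rightarrow> if j = a then coefficient x v else 0)"
  by transfer simp

lemma coefficient_left_shift_power:
  assumes "v \<in> unprefixed a"
  shows "coefficient ((left_shift a ^^ j) x) (replicate k a @ v)
    = (if j \<le> k then coefficient x (replicate (k - j) a @ v) else 0)"
proof (induction j arbitrary: k)
  case (Suc j)
  show ?case
  proof (cases k)
    case 0
    then show ?thesis
      using assms by (auto simp: coefficient_left_shift unprefixed_def split: list.split)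
  qed (simp add: coefficient_left_shift Suc.IH)
qed simp

text \<open>The operator \<open>\<Sum>\<^sub>j c\<^sub>j L\<^sup>j\<close>. The sum is cut off at the length of the word because \<open>L\<^sup>j x\<close>
  vanishes on words shorter than \<open>j\<close>, so no convergence question arises for the coefficients. That
  they are square-summable requires a bound on \<open>c\<close>; without one the value is unspecified.\<close>

definition shift_series :: "(nat \<Rightarrow> complex) \<Rightarrow> 'd \<Rightarrow> 'd fock \<Rightarrow> 'd fock" where
  "shift_series c a x = Abs_fock (\<lambda>w. \<Sum>j\<le>length w. c j * coefficient ((left_shift a ^^ j) x) w)"

lemma shift_series_sum_unprefixed:
  assumes "v \<in> unprefixed a" "k \<le> n"
  shows "(\<Sum>j\<le>n. c j * coefficient ((left_shift a ^^ j) x) (replicate k a @ v))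
    = (\<Sum>j\<le>k. c j * coefficient x (replicate (k - j) a @ v))"
  using assms by (intro sum.mono_neutral_cong_right) (auto simp: coefficient_left_shift_power)

text \<open>A finite set of words is contained in finitely many orbits \<open>{a\<^sup>k v | k \<le> K}\<close>. On each of them
  the operator acts as convolution with \<open>c\<close>, and the bounds add up by orthogonality.\<close>

lemma shift_series_sum_bound:
  assumes c: "convolution_bound c B" and "finite W"
  shows "(\<Sum>w\<in>W. (cmod (\<Sum>j\<le>length w. c j * coefficient ((left_shift a ^^ j) x) w))\<^sup>2)
    \<le> (B * norm x)\<^sup>2"
proof -
  let ?g = "\<lambda>w. \<Sum>j\<le>length w. c j * coefficient ((left_shift a ^^ j) x) w"
  let ?h = "\<lambda>(k, v). replicate k a @ v"
  define V where "V = dropWhile ((=) a) ` W"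
  obtain K where K: "\<And>w. w \<in> W \<Longrightarrow> length w \<le> K"
    using finite_nat_set_iff_bounded_le[of "length ` W"] \<open>finite W\<close> by auto
  have V: "finite V" "V \<subseteq> unprefixed a"
    using \<open>finite W\<close> dropWhile_in_unprefixed by (auto simp: V_def)
  have inj: "inj_on ?h ({..K} \<times> V)"
    using V(2) by (auto simp: inj_on_def replicate_append_eq_iff subset_iff)
  have W: "W \<subseteq> ?h ` ({..K} \<times> V)"
  proof
    fix w
    assume w: "w \<in> W"
    have "w = ?h (length (takeWhile ((=) a) w), dropWhile ((=) a) w)"
      using word_eq_replicate_append[of w a] by (simp only: prod.case)
    moreover have "length (takeWhile ((=) a) w) \<le> K"
      using K[OF w] length_takeWhile_le order_trans by blast
    ultimately show "w \<in> ?h ` ({..K} \<times> V)"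
      using w unfolding V_def by (intro image_eqI) auto
  qed
  have "(\<Sum>w\<in>W. (cmod (?g w))\<^sup>2) \<le> (\<Sum>w\<in>?h ` ({..K} \<times> V). (cmod (?g w))\<^sup>2)"
    using V W by (intro sum_mono2) auto
  also have "\<dots> = (\<Sum>k\<le>K. \<Sum>v\<in>V. (cmod (?g (replicate k a @ v)))\<^sup>2)"
    by (subst sum.reindex[OF inj]) (simp add: sum.cartesian_product case_prod_unfold)
  also have "\<dots> = (\<Sum>v\<in>V. \<Sum>k\<le>K. (cmod (?g (replicate k a @ v)))\<^sup>2)"
    by (rule sum.swap)
  also have "\<dots> = (\<Sum>v\<in>V. \<Sum>k\<le>K. (cmod (\<Sum>j\<le>k. c j * coefficient x (replicate (k - j) a @ v)))\<^sup>2)"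
    using V(2) by (intro sum.cong refl) (subst shift_series_sum_unprefixed; auto)
  also have "\<dots> \<le> (\<Sum>v\<in>V. B\<^sup>2 * (\<Sum>k\<le>K. (cmod (coefficient x (replicate k a @ v)))\<^sup>2))"
    by (intro sum_mono convolution_boundD(2)[OF c])
  also have "\<dots> = B\<^sup>2 * (\<Sum>k\<le>K. \<Sum>v\<in>V. (cmod (coefficient x (replicate k a @ v)))\<^sup>2)"
    by (subst sum.swap) (simp add: sum_distrib_left)
  also have "\<dots> = B\<^sup>2 * (\<Sum>w\<in>?h ` ({..K} \<times> V). (cmod (coefficient x w))\<^sup>2)"
    by (subst sum.reindex[OF inj]) (simp add: sum.cartesian_product case_prod_unfold)
  also have "\<dots> \<le> B\<^sup>2 * (norm x)\<^sup>2"
    using V by (intro mult_left_mono sum_coefficient_le_norm) auto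
  finally show ?thesis
    by (simp add: power_mult_distrib)
qed

context
  fixes c :: "nat \<Rightarrow> complex" and B :: real
  assumes c: "convolution_bound c B"
begin

lemma coefficient_shift_series:
  "coefficient (shift_series c a x) w = (\<Sum>j\<le>length w. c j * coefficient ((left_shift a ^^ j) x) w)"
proof -
  have "square_summable (\<lambda>w. \<Sum>j\<le>length w. c j * coefficient ((left_shift a ^^ j) x) w)"
    by (rule square_summableI) (rule shift_series_sum_bound[OF c])
  then show ?thesis
    unfolding shift_series_def by (subst Abs_fock_inverse) simp_all
qed

lemma coefficient_shift_series_unprefixed:
  assumes "v \<in> unprefixed a"
  shows "coefficient (shift_series c a x) (replicate k a @ v)
    = (\<Sum>j\<le>k. c j * coefficient x (replicate (k - j) a @ v))"
  unfolding coefficient_shift_series using assms by (rule shift_series_sum_unprefixed) simp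

lemma norm_shift_series_le: "norm (shift_series c a x) \<le> B * norm x"
proof (rule norm_fock_leI)
  show "0 \<le> B * norm x"
    using convolution_boundD(1)[OF c] by simp
  show "(\<Sum>w\<in>W. (cmod (coefficient (shift_series c a x) w))\<^sup>2) \<le> (B * norm x)\<^sup>2" if "finite W" for W
    unfolding coefficient_shift_series using that by (rule shift_series_sum_bound[OF c])
qed

lemma bounded_clinear_shift_series: "bounded_clinear (shift_series c a)"
proof (rule bounded_clinearI[OF _ _ norm_shift_series_le])
  show "shift_series c a (x + y) = shift_series c a x + shift_series c a y" for x y
  proof (rule fock_eqI)
    fix w
    obtain k v where "w = replicate k a @ v" "v \<in> unprefixed a"
      by (rule word_decomposition)
    then show "coefficient (shift_series c a (x + y)) w
        = coefficient (shift_series c a x + shift_series c a y) w"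
      by (simp add: coefficient_shift_series_unprefixed algebra_simps sum.distrib)
  qed
  show "shift_series c a (d *\<^sub>C x) = d *\<^sub>C shift_series c a x" for d x
  proof (rule fock_eqI)
    fix w
    obtain k v where "w = replicate k a @ v" "v \<in> unprefixed a"
      by (rule word_decomposition)
    then show "coefficient (shift_series c a (d *\<^sub>C x)) w = coefficient (d *\<^sub>C shift_series c a x) w"
      by (simp add: coefficient_shift_series_unprefixed algebra_simps sum_distrib_left)
  qed
qed

end

section \<open>The functional calculus of a left shift\<close>

lemma coefficient_poly_op_unprefixed:
  assumes "v \<in> unprefixed a"
  shows "coefficient (poly_op p (left_shift a) x) (replicate k a @ v)
    = (\<Sum>j\<le>k. coeff p j * coefficient x (replicate (k - j) a @ v))"
  unfolding poly_op_def coefficient_sum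
  using assms by (intro sum.mono_neutral_cong) (auto simp: coefficient_left_shift_power coeff_eq_0)

text \<open>For any polynomial \<open>p\<close> the operator \<open>p(L) - \<Sum>\<^sub>j c\<^sub>j L\<^sup>j\<close> is again a power series in \<open>L\<close>, with
  coefficients \<open>p\<^sub>j - c\<^sub>j\<close>, and its norm is at most the distance of \<open>p\<close> to \<open>f\<close> on the circle. So the
  series has the defining property of \<open>f(L)\<close>. It is the only such operator since the Fejer means
  provide one sequence of polynomials along which any two candidates have the same limit.\<close>

lemma disk_calculus_left_shift:
  fixes f :: "complex \<Rightarrow> complex" and a :: 'd
  assumes f: "continuous_on (sphere 0 1) f" and analytic: "\<forall>j<0. fourier_coeff f j = 0"
  defines "c \<equiv> \<lambda>j. fourier_coeff f (int j)"
  obtains B where "convolution_bound c B" "disk_calculus f (left_shift a) = shift_series c a"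
proof -
  have "compact (f ` sphere 0 1)"
    using f by (intro compact_continuous_image) auto
  then obtain B where B: "\<And>z. z \<in> sphere 0 1 \<Longrightarrow> cmod (f z) \<le> B"
    using compact_imp_bounded bounded_iff by (metis (no_types, lifting) imageI)
  have c: "convolution_bound c B"
    using convolution_bound_fourier[OF f analytic, of 0 B] B
    by (simp add: c_def convolution_bound_minus)
  let ?F = "shift_series c a"
  let ?limit = "\<lambda>F. \<forall>p :: nat \<Rightarrow> complex poly. uniform_limit (sphere 0 1) (\<lambda>n. poly (p n)) f
      sequentially \<longrightarrow>
    (\<lambda>n. onorm (\<lambda>x. poly_op (p n) (left_shift a) x - F x)) \<longlonglongrightarrow> 0"
  have diff: "poly_op p (left_shift a) x - ?F x = shift_series (\<lambda>j. coeff p j - c j) a x"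
    if "convolution_bound (\<lambda>j. coeff p j - c j) e" for p e x
  proof (rule fock_eqI)
    fix w
    obtain k v where "w = replicate k a @ v" "v \<in> unprefixed a"
      by (rule word_decomposition)
    then show "coefficient (poly_op p (left_shift a) x - ?F x) w
        = coefficient (shift_series (\<lambda>j. coeff p j - c j) a x) w"
      by (simp add: coefficient_poly_op_unprefixed coefficient_shift_series_unprefixed[OF that]
          coefficient_shift_series_unprefixed[OF c] left_diff_distrib sum_subtractf)
  qed
  have poly_op: "bounded_clinear (poly_op p (left_shift a))" for p
  proof -
    obtain e where e: "\<And>z. z \<in> sphere 0 1 \<Longrightarrow> cmod (poly p z - f z) \<le> e"
    proof -
      have "compact ((\<lambda>z. poly p z - f z) ` sphere 0 1)"
        by (intro compact_continuous_image continuous_intros f) auto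
      then show ?thesis
        using compact_imp_bounded bounded_iff that by (metis (no_types, lifting) imageI)
    qed
    then have e: "convolution_bound (\<lambda>j. coeff p j - c j) e"
      unfolding c_def by (rule convolution_bound_fourier[OF f analytic])
    have eq: "poly_op p (left_shift a) x = shift_series (\<lambda>j. coeff p j - c j) a x + ?F x" for x
      using diff[OF e, of x] by (simp add: algebra_simps)
    note D = bounded_clinearD[OF bounded_clinear_shift_series[OF e]]
      bounded_clinearD[OF bounded_clinear_shift_series[OF c]]
    show ?thesis
    proof (rule bounded_clinearI)
      show "poly_op p (left_shift a) (x + y)
          = poly_op p (left_shift a) x + poly_op p (left_shift a) y" for x y
        by (simp add: eq D)
      show "poly_op p (left_shift a) (d *\<^sub>C x) = d *\<^sub>C poly_op p (left_shift a) x" for d x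
        by (simp add: eq D fock.scale_right_distrib)
      show "norm (poly_op p (left_shift a) x) \<le> (e + B) * norm x" for x
        using norm_triangle_mono[OF norm_shift_series_le[OF e] norm_shift_series_le[OF c]]
        by (simp add: eq distrib_right)
    qed
  qed
  have limit: "?limit ?F"
  proof (intro allI impI tendstoI)
    fix p :: "nat \<Rightarrow> complex poly" and e :: real
    assume p: "uniform_limit (sphere 0 1) (\<lambda>n. poly (p n)) f sequentially" and e: "e > 0"
    from uniform_limitD[OF p, of "e / 2"] e
    have "\<forall>\<^sub>F n in sequentially. \<forall>z\<in>sphere 0 1. dist (poly (p n) z) (f z) < e / 2"
      by simp
    then show "\<forall>\<^sub>F n in sequentially. dist (onorm (\<lambda>x. poly_op (p n) (left_shift a) x - ?F x)) 0 < e"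
    proof eventually_elim
      case (elim n)
      have cb: "convolution_bound (\<lambda>j. coeff (p n) j - c j) (e / 2)"
        unfolding c_def
        by (rule convolution_bound_fourier[OF f analytic]) (use elim in \<open>auto simp: dist_norm
            less_imp_le\<close>)
      have "onorm (shift_series (\<lambda>j. coeff (p n) j - c j) a) \<le> e / 2"
        using e by (intro onorm_bound norm_shift_series_le cb) simp
      moreover have "0 \<le> onorm (shift_series (\<lambda>j. coeff (p n) j - c j) a)"
        by (rule onorm_pos_le[OF bounded_clinearD(1)[OF bounded_clinear_shift_series[OF cb]]])
      ultimately show ?case
        using e by (simp add: diff[OF cb])
    qed
  qed
  have "disk_calculus f (left_shift a) = ?F"
    unfolding disk_calculus_def
  proof (rule the_equality)
    show "bounded_clinear ?F \<and> ?limit ?F"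
      by (intro conjI limit bounded_clinear_shift_series[OF c])
  next
    fix G
    assume G: "bounded_clinear G \<and> ?limit G"
    have tendsto: "(\<lambda>n. poly_op (fejer_poly f n) (left_shift a) x) \<longlonglongrightarrow> H x"
      if H: "bounded_clinear H" "?limit H" for H x
    proof -
      let ?D = "\<lambda>n x. poly_op (fejer_poly f n) (left_shift a) x - H x"
      have lim: "(\<lambda>n. onorm (?D n)) \<longlonglongrightarrow> 0"
        by (rule H(2)[rule_format, OF fejer_uniform_limit[OF f analytic]])
      have "norm (?D n x) \<le> onorm (?D n) * norm x" for n
        by (rule onorm[OF bounded_linear_sub[OF bounded_clinearD(1)[OF poly_op]
            bounded_clinearD(1)[OF H(1)]]])
      then have "\<forall>\<^sub>F n in sequentially. norm (?D n x) \<le> onorm (?D n) * norm x"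
        by simp
      then have "(\<lambda>n. ?D n x) \<longlonglongrightarrow> 0"
        by (rule Lim_null_comparison[OF _ tendsto_mult_left_zero[OF lim]])
      then show ?thesis
        by (simp add: Lim_null[symmetric])
    qed
    show "G = ?F"
    proof
      fix x
      show "G x = ?F x"
        by (rule LIMSEQ_unique[OF tendsto[OF conjunct1[OF G] conjunct2[OF G]]
              tendsto[OF bounded_clinear_shift_series[OF c] limit]])
    qed
  qed
  with c that show thesis
    by blast
qed

section \<open>Right shifts\<close>

lemma coefficient_right_shift:
  "coefficient (right_shift i x) w = (if w \<noteq> [] \<and> last w = i then coefficient x (butlast w) else 0)"
  by transfer simp

lemma cinner_right_shift:
  "cinner (right_shift i x) (right_shift j y) = of_bool (i = j) * cinner x y"
proof (cases "i = j")
  case True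
  have "cinner (right_shift i x) (right_shift i y)
      = (\<Sum>\<^sub>\<infinity>w\<in>range (\<lambda>w. w @ [i]). coefficient (right_shift i x) w
          * cnj (coefficient (right_shift i y) w))"
    unfolding cinner.rep_eq
  proof (rule infsum_cong_neutral)
    fix w
    assume "w \<in> UNIV - range (\<lambda>w. w @ [i])"
    then have "\<not> (w \<noteq> [] \<and> last w = i)"
      by (metis DiffE append_butlast_last_id rangeI)
    then show "coefficient (right_shift i x) w * cnj (coefficient (right_shift i y) w) = 0"
      by (auto simp: coefficient_right_shift)
  qed auto
  also have "\<dots> = cinner x y"
    unfolding cinner.rep_eq
    by (subst infsum_reindex) (auto simp: inj_def o_def coefficient_right_shift)
  finally show ?thesis
    using True by simp
next
  case False
  then have "coefficient (right_shift i x) w * cnj (coefficient (right_shift j y) w) = 0" for w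
    by (auto simp: coefficient_right_shift)
  then show ?thesis
    using False unfolding cinner.rep_eq by (simp only: infsum_0) simp
qed

lemma bounded_clinear_right_shift: "bounded_clinear (right_shift i)"
proof (rule bounded_clinearI)
  show "right_shift i (x + y) = right_shift i x + right_shift i y" for x y
    by (rule fock_eqI) (simp add: coefficient_right_shift)
  show "right_shift i (c *\<^sub>C x) = c *\<^sub>C right_shift i x" for c x
    by (rule fock_eqI) (simp add: coefficient_right_shift)
  have "complex_of_real ((norm (right_shift i x))\<^sup>2) = complex_of_real ((norm x)\<^sup>2)" for x
    unfolding cinner_self[symmetric] cinner_right_shift by simp
  then have "norm (right_shift i x) = norm x" for x
    by (metis norm_ge_zero of_real_eq_iff power2_eq_iff_nonneg)
  then show "norm (right_shift i x) \<le> 1 * norm x" for x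
    by simp
qed

lemma left_shift_power_right_shift:
  "(left_shift a ^^ j) (right_shift i x) = right_shift i ((left_shift a ^^ j) x)"
proof -
  have "left_shift a (right_shift i x) = right_shift i (left_shift a x)" for x
    by (rule fock_eqI)
      (auto simp: coefficient_left_shift coefficient_right_shift split: list.split)
  then show ?thesis
    by (induction j) auto
qed

lemma coefficient_left_shift_power_short:
  "length w < j \<Longrightarrow> coefficient ((left_shift a ^^ j) x) w = 0"
proof (induction j arbitrary: w)
  case (Suc j)
  then show ?case
    by (cases w) (auto simp: coefficient_left_shift)
qed simp

text \<open>Left and right shifts commute because they act on opposite ends of a word. For the series
  one also has to compare the cut-offs, which differ by one; the additional term vanishes.\<close>

lemma shift_series_right_shift:
  assumes c: "convolution_bound c B"
  shows "shift_series c a (right_shift i x) = right_shift i (shift_series c a x)"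
proof (rule fock_eqI)
  fix w
  show "coefficient (shift_series c a (right_shift i x)) w
      = coefficient (right_shift i (shift_series c a x)) w"
  proof (cases "w \<noteq> [] \<and> last w = i")
    case True
    then have "length w = Suc (length (butlast w))"
      by simp
    then show ?thesis
      using True
      by (simp add: coefficient_shift_series[OF c] left_shift_power_right_shift coefficient_right_shift
          coefficient_left_shift_power_short del: length_butlast funpow.simps)
  qed (auto simp: coefficient_shift_series[OF c] left_shift_power_right_shift coefficient_right_shift)
qed

section \<open>The operator \<open>F + F\<^sup>*\<close>\<close>

lemma bounded_clinear_add_adj:
  assumes "bounded_clinear F"
  shows "bounded_clinear (\<lambda>x. F x + adj F x)"
proof (rule bounded_clinearI)
  note D = bounded_clinearD[OF assms] bounded_clinearD[OF bounded_clinear_adj[OF assms]]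
  show "F (x + y) + adj F (x + y) = F x + adj F x + (F y + adj F y)" for x y
    by (simp add: D)
  show "F (c *\<^sub>C x) + adj F (c *\<^sub>C x) = c *\<^sub>C (F x + adj F x)" for c x
    by (simp add: D fock.scale_right_distrib)
  show "norm (F x + adj F x) \<le> (onorm F + onorm (adj F)) * norm x" for x
    using norm_triangle_mono[OF onorm[OF D(1)] onorm[OF D(7)]] by (simp add: distrib_right)
qed

lemma cinner_add_adj:
  assumes "bounded_clinear F"
  shows "cinner (F x + adj F x) y = cinner (F x) y + cnj (cinner (F y) x)"
  using cinner_adj[OF assms, of y x] cinner_commute[of "adj F x" y]
  by (simp add: cinner_add_left)

lemma self_adjoint_add_adj:
  assumes "bounded_clinear F"
  shows "self_adjoint (\<lambda>x. F x + adj F x)"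
  unfolding self_adjoint_def
proof (intro allI)
  fix x y
  have "cinner x (F y + adj F y) = cnj (cinner (F y + adj F y) x)"
    by (rule cinner_commute)
  then show "cinner (F x + adj F x) y = cinner x (F y + adj F y)"
    by (simp add: cinner_add_adj[OF assms])
qed

text \<open>Moving both right shifts to the outside of \<open>\<langle>F R\<^sub>j x, R\<^sub>i y\<rangle>\<close> and of its adjoint counterpart
  leaves \<open>R\<^sub>i\<^sup>* R\<^sub>j = \<delta>\<^sub>i\<^sub>j\<close>.\<close>

lemma multi_Toeplitz_add_adj:
  assumes F: "bounded_clinear F" and comm: "\<And>i x. F (right_shift i x) = right_shift i (F x)"
  shows "multi_Toeplitz (\<lambda>x. F x + adj F x)"
  unfolding multi_Toeplitz_def
proof (intro allI ext)
  fix i j x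
  let ?T = "\<lambda>x. F x + adj F x"
  let ?l = "(adj (right_shift i) \<circ> ?T \<circ> right_shift j) x"
  have "cinner ?l y = cinner (if i = j then ?T x else 0) y" for y
  proof -
    have "cinner ?l y = cnj (cinner (right_shift i y) (?T (right_shift j x)))"
      using cinner_adj[OF bounded_clinear_right_shift, of i y "?T (right_shift j x)"]
        cinner_commute[of ?l y] by simp
    also have "\<dots> = cinner (?T (right_shift j x)) (right_shift i y)"
      by (rule cinner_commute[symmetric])
    also have "\<dots> = cinner (F (right_shift j x)) (right_shift i y)
        + cnj (cinner (F (right_shift i y)) (right_shift j x))"
      by (rule cinner_add_adj[OF F])
    also have "\<dots> = cinner (if i = j then ?T x else 0) y"
      by (auto simp: cinner_add_adj[OF F] comm cinner_right_shift)
    finally show ?thesis .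
  qed
  then have "?l = (if i = j then ?T x else 0)"
    by (rule cinner_eqI)
  then show "?l = (if i = j then ?T else (\<lambda>_. 0)) x"
    by simp
qed

text \<open>The matrix of \<open>F + F\<^sup>*\<close> in the basis of words is block diagonal with respect to the heads
  \<open>v\<close>, with a Toeplitz matrix in every block. On the diagonal both summands contribute.\<close>

lemma coefficient_add_adj_shift_series:
  assumes c: "convolution_bound c B" and v: "v \<in> unprefixed a" "v' \<in> unprefixed a"
  shows "coefficient (shift_series c a (\<xi> (replicate l a @ v))
      + adj (shift_series c a) (\<xi> (replicate l a @ v)))
      (replicate k a @ v')
    = (if v = v' then (if l \<le> k then c (k - l) else 0) + (if k \<le> l then cnj (c (l - k)) else 0) else 0)"
proof -
  have *: "coefficient (shift_series c a (\<xi> (replicate l a @ v))) (replicate k a @ v')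
      = (if v = v' \<and> l \<le> k then c (k - l) else 0)"
    if "v \<in> unprefixed a" "v' \<in> unprefixed a" for k l v v'
  proof -
    have "coefficient (shift_series c a (\<xi> (replicate l a @ v))) (replicate k a @ v')
        = (\<Sum>j\<le>k. if j = k - l then if v = v' \<and> l \<le> k then c (k - l) else 0 else 0)"
      unfolding coefficient_shift_series_unprefixed[OF c that(2)] coefficient_\<xi>
        replicate_append_eq_iff[OF that(2,1)]
      by (intro sum.cong) auto
    then show ?thesis
      by simp
  qed
  show ?thesis
    unfolding coefficient_eq_cinner cinner_add_adj[OF bounded_clinear_shift_series[OF c]]
    unfolding coefficient_eq_cinner[symmetric] using v by (auto simp: *)
qed

section \<open>Diagonalization of Hermitian matrices\<close>

text \<open>A Jordan matrix is bidiagonal, and a nonzero entry above the diagonal occurs only within a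
  block, where the diagonal is constant.\<close>

lemma jordan_matrix_entry:
  assumes "i < sum_list (map fst n_as)" "j < sum_list (map fst n_as)" "jordan_matrix n_as $$ (i, j) \<noteq> 0"
  shows "j = i \<or> j = Suc i \<and> jordan_matrix n_as $$ (i, i) = jordan_matrix n_as $$ (j, j)"
  using assms
proof (induction n_as arbitrary: i j)
  case (Cons na n_as)
  obtain n e where na: "na = (n, e)"
    by force
  let ?J = "jordan_matrix n_as"
  let ?m = "sum_list (map fst n_as)"
  have J: "jordan_matrix (na # n_as) = four_block_mat (jordan_block n e) (0\<^sub>m n ?m) (0\<^sub>m ?m n) ?J"
    using jordan_matrix_dim[of n_as] by (simp add: jordan_matrix_def na Let_def)
  have entry: "jordan_matrix (na # n_as) $$ (i, j) =
      (if i < n then if j < n then jordan_block n e $$ (i, j) else 0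
       else if j < n then 0 else ?J $$ (i - n, j - n))" if "i < n + ?m" "j < n + ?m" for i j
    unfolding J using that by (subst index_mat_four_block(1)) auto
  have ij: "i < n + ?m" "j < n + ?m"
    using Cons.prems by (auto simp: na)
  show ?case
  proof (cases "i < n")
    case True
    then have "j < n \<and> (j = i \<or> j = Suc i)"
      using Cons.prems(3) unfolding entry[OF ij] by (auto split: if_splits)
    then show ?thesis
      unfolding entry[OF ij(1) ij(1)] entry[OF ij(2) ij(2)] using True by auto
  next
    case False
    then have j: "\<not> j < n" and nz: "?J $$ (i - n, j - n) \<noteq> 0"
      using Cons.prems(3) unfolding entry[OF ij] by (auto split: if_splits)
    have "j - n = i - n \<or> j - n = Suc (i - n) \<and> ?J $$ (i - n, i - n) = ?J $$ (j - n, j - n)"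
      by (rule Cons.IH[OF _ _ nz]) (use False j ij in auto)
    then show ?thesis
      unfolding entry[OF ij(1) ij(1)] entry[OF ij(2) ij(2)] using False j by auto
  qed
qed simp

text \<open>The columns of \<open>P\<close> are an eigenbasis of \<open>A\<close> for the real eigenvalues \<open>lam\<close>, and \<open>Q\<close> is the
  inverse of \<open>P\<close>. The eigenvalues are enumerated with multiplicity as functions of the column, so
  that they can later index the eigenvectors of the truncations.\<close>

definition diagonalizes :: "nat \<Rightarrow> complex mat \<Rightarrow> complex mat \<Rightarrow> (nat \<Rightarrow> real) \<Rightarrow> complex mat \<Rightarrow> bool" where
  "diagonalizes n P Q lam A \<longleftrightarrow>
    P \<in> carrier_mat n n \<and> Q \<in> carrier_mat n n \<and> P * Q = 1\<^sub>m n \<and> Q * P = 1\<^sub>m n \<and>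
    (\<forall>i<n. \<forall>k<n. (\<Sum>m<n. A $$ (i, m) * P $$ (m, k)) = complex_of_real (lam k) * P $$ (i, k)) \<and>
    char_poly A = (\<Prod>k<n. [:- complex_of_real (lam k), 1:])"

text \<open>Start from the Jordan form \<open>A P = P J\<close> and suppose \<open>J\<close> has a nonzero entry \<open>s\<close> above the
  diagonal. At the first such position, columns \<open>p\<close> and \<open>p'\<close> of \<open>P\<close> satisfy \<open>A p = e p\<close> and
  \<open>A p' = e p' + s p\<close>, where \<open>e\<close> is real. Then
  \<open>e \<langle>p', p\<rangle> + s \<parallel>p\<parallel>\<^sup>2 = \<langle>A p', p\<rangle> = \<langle>p', A p\<rangle> = e \<langle>p', p\<rangle>\<close>, contradicting \<open>p \<noteq> 0\<close>.\<close>

lemma hermitian_diagonalization: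
  fixes A :: "complex mat"
  assumes A: "A \<in> carrier_mat n n"
    and hermitian: "\<And>i j. i < n \<Longrightarrow> j < n \<Longrightarrow> A $$ (j, i) = cnj (A $$ (i, j))"
  shows "\<exists>P Q lam. diagonalizes n P Q lam A"
proof -
  obtain as where "char_poly A = (\<Prod>a\<leftarrow>as. [:- a, 1:])"
    using char_poly_factorized[OF A] by blast
  then obtain n_as where "jordan_nf A n_as"
    using jordan_nf_exists[OF A] by blast
  then have sim: "similar_mat A (jordan_matrix n_as)"
    by (simp add: jordan_nf_def)
  define J where "J = jordan_matrix n_as"
  obtain P Q where PQ: "P \<in> carrier_mat n n" "Q \<in> carrier_mat n n" "P * Q = 1\<^sub>m n" "Q * P = 1\<^sub>m n"
    and J: "J \<in> carrier_mat n n" and APJ: "A = P * J * Q"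
    using sim A unfolding similar_mat_def similar_mat_wit_def J_def by (auto simp: Let_def)
  have n: "n = sum_list (map fst n_as)"
    using carrier_matD(1)[OF J] jordan_matrix_dim(1)[of n_as] by (simp add: J_def)
  have J_entry: "k = m \<or> k = Suc m \<and> J $$ (m, m) = J $$ (k, k)"
    if "m < n" "k < n" "J $$ (m, k) \<noteq> 0" for m k
    using jordan_matrix_entry[of m n_as k] that by (simp add: n[symmetric] J_def[symmetric])
  have "A * P = P * J * (Q * P)"
    unfolding APJ using PQ J by (simp add: assoc_mult_mat[of _ n n _ n _ n])
  then have AP: "A * P = P * J"
    using PQ J by simp
  have AP_entry: "(\<Sum>m<n. A $$ (i, m) * P $$ (m, k)) = (\<Sum>m<n. P $$ (i, m) * J $$ (m, k))"
    if "i < n" "k < n" for i k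
  proof -
    have "(A * P) $$ (i, k) = (P * J) $$ (i, k)"
      by (simp only: AP)
    then show ?thesis
      using that A PQ J by (simp add: scalar_prod_def lessThan_atLeast0)
  qed
  \<comment> \<open>The squared norm of column \<open>k\<close>, which is nonzero as \<open>P\<close> is invertible.\<close>
  define s where "s = (\<lambda>k. \<Sum>i<n. P $$ (i, k) * cnj (P $$ (i, k)))"
  have s: "s k \<noteq> 0" if "k < n" for k
  proof
    assume "s k = 0"
    then have "complex_of_real (\<Sum>i<n. (cmod (P $$ (i, k)))\<^sup>2) = 0"
      by (simp add: s_def complex_norm_square del: of_real_power)
    then have "(\<Sum>i<n. (cmod (P $$ (i, k)))\<^sup>2) = 0"
      by (simp only: of_real_eq_0_iff)
    then have "P $$ (i, k) = 0" if "i < n" for i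
      using that by (simp add: sum_nonneg_eq_0_iff)
    then have "(Q * P) $$ (k, k) = 0"
      using PQ(1,2) \<open>k < n\<close> by (simp add: scalar_prod_def)
    then show False
      using PQ(4) \<open>k < n\<close> by simp
  qed
  \<comment> \<open>\<open>A\<close> can be moved between the two arguments of the standard inner product.\<close>
  have sym: "(\<Sum>i<n. (\<Sum>m<n. A $$ (i, m) * P $$ (m, k)) * cnj (P $$ (i, l)))
      = (\<Sum>i<n. P $$ (i, k) * cnj (\<Sum>m<n. A $$ (i, m) * P $$ (m, l)))" for k l
  proof -
    have "(\<Sum>i<n. (\<Sum>m<n. A $$ (i, m) * P $$ (m, k)) * cnj (P $$ (i, l)))
        = (\<Sum>i<n. \<Sum>m<n. A $$ (i, m) * P $$ (m, k) * cnj (P $$ (i, l)))"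
      by (simp add: sum_distrib_right)
    also have "\<dots> = (\<Sum>m<n. \<Sum>i<n. A $$ (i, m) * P $$ (m, k) * cnj (P $$ (i, l)))"
      by (rule sum.swap)
    also have "\<dots> = (\<Sum>m<n. \<Sum>i<n. P $$ (m, k) * cnj (A $$ (m, i) * P $$ (i, l)))"
    proof (intro sum.cong refl)
      fix m i
      assume "m \<in> {..<n}" "i \<in> {..<n}"
      then have "A $$ (i, m) = cnj (A $$ (m, i))"
        by (intro hermitian) auto
      then show "A $$ (i, m) * P $$ (m, k) * cnj (P $$ (i, l))
          = P $$ (m, k) * cnj (A $$ (m, i) * P $$ (i, l))"
        by simp
    qed
    finally show ?thesis
      by (simp add: sum_distrib_left)
  qed
  have real: "J $$ (k, k) = cnj (J $$ (k, k))"
    if "k < n" and eig: "\<And>i. i < n \<Longrightarrow> (\<Sum>m<n. A $$ (i, m) * P $$ (m, k)) = J $$ (k, k) * P $$ (i, k)" for k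
  proof -
    have "J $$ (k, k) * s k = cnj (J $$ (k, k)) * s k"
      using sym[of k k] by (simp add: eig s_def sum_distrib_left mult_ac)
    then show ?thesis
      using s[OF that(1)] by simp
  qed
  have diag: "J $$ (m, k) = 0" if "m < n" "k < n" "m \<noteq> k" for m k
  proof (rule ccontr)
    assume "J $$ (m, k) \<noteq> 0"
    with J_entry[OF that(1,2)] that(3) have "Suc m < n \<and> J $$ (m, Suc m) \<noteq> 0"
      using that(2) by auto
    \<comment> \<open>The first Jordan block of size at least two starts at \<open>m\<close>.\<close>
    define m where "m = (LEAST m. Suc m < n \<and> J $$ (m, Suc m) \<noteq> 0)"
    have m: "Suc m < n" "J $$ (m, Suc m) \<noteq> 0"
      unfolding m_def using LeastI[of "\<lambda>m. Suc m < n \<and> J $$ (m, Suc m) \<noteq> 0"]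
        \<open>Suc _ < n \<and> _\<close> by blast+
    have first: "J $$ (l, m) = 0" if "l < n" "l \<noteq> m" for l
    proof (rule ccontr)
      assume nz: "J $$ (l, m) \<noteq> 0"
      then have "m = Suc l"
        using J_entry[OF that(1) _ nz] m that by simp
      then show False
        using nz m not_less_Least[of l "\<lambda>m. Suc m < n \<and> J $$ (m, Suc m) \<noteq> 0"] unfolding m_def[symmetric]
        by auto
    qed
    let ?e = "J $$ (m, m)"
    have e: "J $$ (Suc m, Suc m) = ?e"
      using J_entry[of m "Suc m"] m by auto
    have eig: "(\<Sum>j<n. A $$ (i, j) * P $$ (j, m)) = ?e * P $$ (i, m)" if "i < n" for i
    proof -
      have "(\<Sum>j<n. P $$ (i, j) * J $$ (j, m)) = (\<Sum>j<n. if j = m then ?e * P $$ (i, m) else 0)"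
        using first by (intro sum.cong) auto
      then show ?thesis
        using AP_entry[OF that] m by simp
    qed
    have next_col: "(\<Sum>j<n. A $$ (i, j) * P $$ (j, Suc m))
        = ?e * P $$ (i, Suc m) + J $$ (m, Suc m) * P $$ (i, m)"
      if "i < n" for i
    proof -
      have "J $$ (j, Suc m) = 0" if "j < n" "j \<noteq> m" "j \<noteq> Suc m" for j
        using J_entry[of j "Suc m"] that m by auto
      then have "(\<Sum>j<n. P $$ (i, j) * J $$ (j, Suc m)) = (\<Sum>j\<in>{m, Suc m}. P $$ (i, j) * J $$ (j, Suc m))"
        using m by (intro sum.mono_neutral_right) auto
      then show ?thesis
        using AP_entry[OF that, of "Suc m"] m by (simp add: e mult.commute)
    qed
    have "cnj ?e = ?e"
      using real[of m] eig m by simp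
    have "(\<Sum>i<n. (?e * P $$ (i, Suc m) + J $$ (m, Suc m) * P $$ (i, m)) * cnj (P $$ (i, m)))
        = (\<Sum>i<n. P $$ (i, Suc m) * cnj (?e * P $$ (i, m)))"
      using sym[of "Suc m" m] by (simp add: eig next_col)
    then have "J $$ (m, Suc m) * s m = 0"
      by (simp add: \<open>cnj ?e = ?e\<close> s_def algebra_simps sum.distrib sum_distrib_left)
    then show False
      using m s[of m] by simp
  qed
  have eig: "(\<Sum>j<n. A $$ (i, j) * P $$ (j, k)) = J $$ (k, k) * P $$ (i, k)" if "i < n" "k < n" for i k
  proof -
    have "(\<Sum>j<n. P $$ (i, j) * J $$ (j, k)) = (\<Sum>j<n. if j = k then J $$ (k, k) * P $$ (i, k) else 0)"
      using diag that by (intro sum.cong) auto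
    then show ?thesis
      using AP_entry[OF that] that by simp
  qed
  define lam where "lam k = Re (J $$ (k, k))" for k
  have lam: "J $$ (k, k) = complex_of_real (lam k)" if "k < n" for k
    using real[of k] eig that by (simp add: lam_def complex_eq_iff)
  have "char_poly A = char_poly J"
    using char_poly_similar[OF sim] by (simp add: J_def)
  also have "\<dots> = (\<Prod>a\<leftarrow>diag_mat J. [:- a, 1:])"
    using J diag by (intro char_poly_upper_triangular) (auto intro!: upper_triangularI)
  also have "\<dots> = (\<Prod>k<n. [:- complex_of_real (lam k), 1:])"
    using J by (simp add: diag_mat_def prod.list_conv_set_nth lessThan_atLeast0 lam)
  finally have "char_poly A = (\<Prod>k<n. [:- complex_of_real (lam k), 1:])" .
  moreover have "(\<Sum>m<n. A $$ (i, m) * P $$ (m, k)) = complex_of_real (lam k) * P $$ (i, k)"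
    if "i < n" "k < n" for i k
    unfolding eig[OF that] lam[OF that(2)] ..
  ultimately have "diagonalizes n P Q lam A"
    unfolding diagonalizes_def using PQ by blast
  then show ?thesis
    by blast
qed

lemma order_prod_linear:
  fixes n :: nat
  shows "order r (\<Prod>k<n. [:- c k, 1 :: complex:]) = card {k. k < n \<and> c k = r}"
proof (induction n)
  case (Suc n)
  have nonzero: "(\<Prod>k<n. [:- c k, 1:]) * [:- c n, 1:] \<noteq> 0"
    by (auto simp del: mult_pCons_right)
  then have "order r (\<Prod>k<Suc n. [:- c k, 1:]) = card {k. k < n \<and> c k = r} + order r [:- c n, 1:]"
    by (simp only: prod.lessThan_Suc order_mult[OF nonzero] Suc.IH)
  also have "order r [:- c n, 1:] = of_bool (c n = r)"
    using order_power_n_n[of r 1] by (auto intro: order_0I)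
  also have "{k. k < Suc n \<and> c k = r} = {k. k < n \<and> c k = r} \<union> (if c n = r then {n} else {})"
    by (auto simp: less_Suc_eq)
  then have "card {k. k < n \<and> c k = r} + of_bool (c n = r) = card {k. k < Suc n \<and> c k = r}"
    by (auto simp: card_insert_if)
  finally show ?case .
qed (simp add: order_0I)

text \<open>A fixed enumeration, by \<open>0, \<dots>, h\<close>, of the eigenvalues with multiplicity. The order is
  arbitrary.\<close>

definition toeplitz_eigenvalue :: "(complex \<Rightarrow> complex) \<Rightarrow> nat \<Rightarrow> nat \<Rightarrow> real" where
  "toeplitz_eigenvalue f h = (SOME lam. \<exists>P Q. diagonalizes (h + 1) P Q lam (toeplitz_matrix f h))"

lemma diagonalizes_toeplitz:
  "\<exists>P Q. diagonalizes (h + 1) P Q (toeplitz_eigenvalue f h) (toeplitz_matrix f h)"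
proof -
  have "toeplitz_matrix f h \<in> carrier_mat (h + 1) (h + 1)"
    by (simp add: toeplitz_matrix_def Let_def)
  moreover have "toeplitz_matrix f h $$ (j, i) = cnj (toeplitz_matrix f h $$ (i, j))"
    if "i < h + 1" "j < h + 1" for i j
    using that by (simp add: toeplitz_matrix_def Let_def add.commute)
  ultimately have "\<exists>P Q lam. diagonalizes (h + 1) P Q lam (toeplitz_matrix f h)"
    by (rule hermitian_diagonalization)
  then have "\<exists>lam P Q. diagonalizes (h + 1) P Q lam (toeplitz_matrix f h)"
    by blast
  from someI_ex[OF this] show ?thesis
    unfolding toeplitz_eigenvalue_def .
qed

text \<open>The same diagonalization in terms of entries, with sums over \<open>{..h}\<close>, as it is used inside
  the Fock space.\<close>

lemma toeplitz_diagonalization: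
  "\<exists>P Q :: nat \<Rightarrow> nat \<Rightarrow> complex. \<forall>i\<le>h. \<forall>l\<le>h.
    (\<Sum>k\<le>h. P i k * Q k l) = of_bool (i = l) \<and> (\<Sum>k\<le>h. Q i k * P k l) = of_bool (i = l) \<and>
    (\<Sum>m\<le>h. toeplitz_matrix f h $$ (i, m) * P m l) = complex_of_real (toeplitz_eigenvalue f h l) * P i l"
proof -
  obtain P Q where PQ: "diagonalizes (h + 1) P Q (toeplitz_eigenvalue f h) (toeplitz_matrix f h)"
    using diagonalizes_toeplitz by blast
  have product: "(\<Sum>k\<le>h. A $$ (i, k) * B $$ (k, l)) = of_bool (i = l)"
    if "A \<in> carrier_mat (h + 1) (h + 1)" "B \<in> carrier_mat (h + 1) (h + 1)" "A * B = 1\<^sub>m (h + 1)" "i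
        \<le> h" "l \<le> h"
    for A B :: "complex mat" and i l
  proof -
    have "(\<Sum>k\<le>h. A $$ (i, k) * B $$ (k, l)) = (A * B) $$ (i, l)"
      using that(1,2,4,5) by (simp add: scalar_prod_def atLeast0LessThan lessThan_Suc_atMost)
    then show ?thesis
      using that(3,4,5) by simp
  qed
  show ?thesis
  proof (intro exI allI impI conjI)
    fix i l
    assume "i \<le> h" "l \<le> h"
    then show "(\<Sum>k\<le>h. P $$ (i, k) * Q $$ (k, l)) = of_bool (i = l)"
      "(\<Sum>k\<le>h. Q $$ (i, k) * P $$ (k, l)) = of_bool (i = l)"
      "(\<Sum>m\<le>h. toeplitz_matrix f h $$ (i, m) * P $$ (m, l))
        = complex_of_real (toeplitz_eigenvalue f h l) * P $$ (i, l)"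
      using PQ by (auto simp: diagonalizes_def product less_Suc_eq_le lessThan_Suc_atMost)
  qed
qed

lemma emeasure_toeplitz_eigenvalue_measure:
  assumes "A \<in> sets borel"
  shows "emeasure (eigenvalue_measure (toeplitz_matrix f h)) A
    = (\<Sum>j\<le>h. indicator A (toeplitz_eigenvalue f h j))"
proof -
  let ?lam = "toeplitz_eigenvalue f h"
  let ?X = "toeplitz_matrix f h"
  have X: "?X \<in> carrier_mat (h + 1) (h + 1)"
    by (simp add: toeplitz_matrix_def Let_def)
  have char_poly: "char_poly ?X = (\<Prod>k\<le>h. [:- complex_of_real (?lam k), 1:])"
    using diagonalizes_toeplitz[of h f] by (auto simp: diagonalizes_def lessThan_Suc_atMost)
  have order: "order (complex_of_real r) (char_poly ?X) = card {j \<in> {..h}. ?lam j = r}" for r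
    unfolding char_poly lessThan_Suc_atMost[symmetric] order_prod_linear
    by (intro arg_cong[of _ _ card]) auto
  have eig: "{r. eigenvalue ?X (complex_of_real r)} = ?lam ` {..h}"
    unfolding eigenvalue_root_char_poly[OF X] char_poly by (auto simp: poly_prod)
  have "emeasure (eigenvalue_measure ?X) A
      = (\<Sum>r\<in>?lam ` {..h}. of_nat (card {j \<in> {..h}. ?lam j = r}) * indicator A r)"
    unfolding emeasure_eigenvalue_measure[OF assms] eig order using assms by simp
  also have "\<dots> = (\<Sum>r\<in>?lam ` {..h}. \<Sum>j | j \<in> {..h} \<and> ?lam j = r. indicator A (?lam j))"
    by (intro sum.cong) auto
  also have "\<dots> = (\<Sum>j\<le>h. indicator A (?lam j))"
    by (rule sum.image_gen[symmetric]) simp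
  finally show ?thesis .
qed

section \<open>Eigenspaces spanned by an eigenbasis\<close>

text \<open>If \<open>A\<close> acts diagonally on a basis \<open>b\<close> of \<open>U\<close>, then comparing coefficients shows that the
  eigenspace for \<open>r\<close> is spanned by those \<open>b\<^sub>i\<close> with eigenvalue \<open>r\<close>. The basis is given as a family
  together with its linear combinations \<open>comb\<close>, so that repeated eigenvalues cause no difficulty.\<close>

lemma eigenspace_of_eigenbasis:
  fixes A :: "'d fock \<Rightarrow> 'd fock" and b :: "'i \<Rightarrow> 'd fock" and lam :: "'i \<Rightarrow> real"
  assumes I: "finite I"
    and comb_def: "comb = (\<lambda>\<alpha>. \<Sum>i\<in>I. \<alpha> i *\<^sub>C b i)"
    and indep: "\<And>\<alpha> i. comb \<alpha> = 0 \<Longrightarrow> i \<in> I \<Longrightarrow> \<alpha> i = 0"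
    and A: "\<And>\<alpha>. A (comb \<alpha>) = comb (\<lambda>i. of_real (lam i) * \<alpha> i)"
    and U: "U = range comb"
    and E: "E = {x \<in> U. A x = of_real r *\<^sub>C x}"
  shows "fock.dim E = card {i \<in> I. lam i = r}"
    and "(\<exists>x\<in>E. x \<noteq> 0) \<longleftrightarrow> (\<exists>i\<in>I. lam i = r)"
proof -
  define J where "J = {i \<in> I. lam i = r}"
  have J: "finite J" "J \<subseteq> I"
    using I by (auto simp: J_def)
  define comb' where "comb' = (\<lambda>\<alpha>. \<Sum>i\<in>J. \<alpha> i *\<^sub>C b i)"
  have comb'_eq: "comb' \<alpha> = comb (\<lambda>i. if i \<in> J then \<alpha> i else 0)" for \<alpha>
    unfolding comb_def comb'_def using I J by (intro sum.mono_neutral_cong_left) auto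
  have comb_single: "comb (\<lambda>i. of_bool (i = k)) = b k" if "k \<in> I" for k
  proof -
    have "comb (\<lambda>i. of_bool (i = k)) = (\<Sum>i\<in>I. if i = k then b k else 0)"
      unfolding comb_def by (intro sum.cong) auto
    then show ?thesis
      using that I by simp
  qed
  have comb_diff: "comb \<alpha> - comb \<beta> = comb (\<lambda>i. \<alpha> i - \<beta> i)" for \<alpha> \<beta>
    by (simp add: comb_def fock.scale_left_diff_distrib sum_subtractf)
  have nonzero: "b k \<noteq> 0" if "k \<in> I" for k
    using indep[of "\<lambda>i. of_bool (i = k)" k] comb_single[OF that] that by auto
  have inj: "inj_on b I"
  proof (rule inj_onI, rule ccontr)
    fix i k
    assume ik: "i \<in> I" "k \<in> I" "b i = b k" "i \<noteq> k"
    then have "comb (\<lambda>l. of_bool (l = i) - of_bool (l = k)) = 0"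
      by (simp add: comb_diff[symmetric] comb_single)
    from indep[OF this ik(1)] ik(4) show False
      by simp
  qed
  have E_eq: "E = range (comb')"
  proof (intro equalityI subsetI)
    fix x
    assume "x \<in> E"
    then obtain \<alpha> where x: "x = comb \<alpha>" and eig: "A x = of_real r *\<^sub>C x"
      by (auto simp: E U)
    have "of_real r *\<^sub>C x = comb (\<lambda>i. of_real r * \<alpha> i)"
      by (simp add: x comb_def fock.scale_sum_right)
    with eig A[of \<alpha>] have "comb (\<lambda>i. of_real (lam i) * \<alpha> i - of_real r * \<alpha> i) = 0"
      unfolding comb_diff[symmetric] x by simp
    from indep[OF this] have "\<alpha> i = 0" if "i \<in> I" "i \<notin> J" for i
      using that by (auto simp: J_def left_diff_distrib[symmetric] simp flip: of_real_diff)
    then have "x = comb' \<alpha>"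
      unfolding x comb'_eq unfolding comb_def by (intro sum.cong) auto
    then show "x \<in> range (comb')"
      by blast
  next
    fix x
    assume "x \<in> range (comb')"
    then obtain \<alpha> where x: "x = comb (\<lambda>i. if i \<in> J then \<alpha> i else 0)"
      by (auto simp: comb'_eq)
    have "A x = of_real r *\<^sub>C x"
      unfolding x A unfolding comb_def fock.scale_sum_right
      by (intro sum.cong) (auto simp: J_def)
    then show "x \<in> E"
      by (auto simp: E U x)
  qed
  have span: "fock.span (b ` J) = range (comb')"
  proof -
    have eq: "(\<Sum>v\<in>b ` J. u v *\<^sub>C v) = comb' (\<lambda>i. u (b i))" for u
      unfolding comb'_def using inj_on_subset[OF inj J(2)] by (simp add: sum.reindex)
    have "comb' \<alpha> = (\<Sum>v\<in>b ` J. (\<alpha> \<circ> the_inv_into I b) v *\<^sub>C v)" for \<alpha>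
      unfolding eq unfolding comb'_def using J(2)
          by (intro sum.cong) (auto simp: the_inv_into_f_f[OF inj])
    then have "range (comb') \<subseteq> range (\<lambda>u. \<Sum>v\<in>b ` J. u v *\<^sub>C v)"
      by (intro image_subsetI) (simp only:, rule rangeI)
    moreover have "range (\<lambda>u. \<Sum>v\<in>b ` J. u v *\<^sub>C v) \<subseteq> range (comb')"
      unfolding eq by blast
    ultimately show ?thesis
      unfolding fock.span_finite[OF finite_imageI[OF J(1)]] by (rule equalityI[rotated])
  qed
  have "fock.independent (b ` J)"
  proof
    assume "fock.dependent (b ` J)"
    then obtain u k where k: "k \<in> J" "u (b k) \<noteq> 0" and "(\<Sum>v\<in>b ` J. u v *\<^sub>C v) = 0"
      unfolding fock.dependent_finite[OF finite_imageI[OF J(1)]] by auto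
    then have "comb' (\<lambda>i. u (b i)) = 0"
      unfolding comb'_def using inj_on_subset[OF inj J(2)] by (simp add: sum.reindex)
    from indep[OF this[unfolded comb'_eq], of k] k J(2) show False
      by auto
  qed
  then have "fock.dim (E) = card (b ` J)"
    by (intro fock.dim_eq_card) (simp_all add: E_eq span[symmetric] fock.span_span)
  then show "fock.dim (E) = card {i \<in> I. lam i = r}"
    using inj J(2) by (simp add: J_def[symmetric] card_image inj_on_subset)
  show "(\<exists>x\<in>E. x \<noteq> 0) \<longleftrightarrow> (\<exists>i\<in>I. lam i = r)"
  proof
    assume "\<exists>x\<in>E. x \<noteq> 0"
    then have "J \<noteq> {}"
      by (auto simp: E_eq comb'_def)
    then show "\<exists>i\<in>I. lam i = r"
      by (auto simp: J_def)
  next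
    assume "\<exists>i\<in>I. lam i = r"
    then obtain i where i: "i \<in> J" "i \<in> I"
      by (auto simp: J_def)
    then have "b i \<in> E"
      unfolding E_eq span[symmetric] by (intro fock.span_base) simp
    then show "\<exists>x\<in>E. x \<noteq> 0"
      using nonzero[OF i(2)] by blast
  qed
qed

section \<open>Block decomposition of the truncations\<close>

lemma coefficient_trunc_proj:
  fixes x :: "'d::finite fock"
  shows "coefficient (trunc_proj N x) w = (if length w \<le> N then coefficient x w else 0)"
proof -
  have fin: "finite {w :: 'd list. length w \<le> N}"
    using finite_lists_length_le[of "UNIV :: 'd set" N] by simp
  have "coefficient (trunc_proj N x) w
      = (\<Sum>u | length u \<le> N. if u = w then coefficient x w else 0)"
    unfolding trunc_proj_def coefficient_sum
    by (intro sum.cong) (auto simp: coefficient_\<xi> coefficient_eq_cinner[symmetric])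
  then show ?thesis
    using fin by (simp add: sum.delta)
qed

lemma trunc_proj_idem: "(\<And>w. length w > N \<Longrightarrow> coefficient x w = 0) \<Longrightarrow> trunc_proj N x = x"
  by (rule fock_eqI) (auto simp: coefficient_trunc_proj not_le)

lemma norm_trunc_proj_le: "norm (trunc_proj N x) \<le> norm x"
proof (rule norm_fock_leI)
  fix W :: "'a list set"
  assume W: "finite W"
  have "(\<Sum>w\<in>W. (cmod (coefficient (trunc_proj N x) w))\<^sup>2) \<le> (\<Sum>w\<in>W. (cmod (coefficient x w))\<^sup>2)"
    by (intro sum_mono) (simp add: coefficient_trunc_proj)
  then show "(\<Sum>w\<in>W. (cmod (coefficient (trunc_proj N x) w))\<^sup>2) \<le> (norm x)\<^sup>2"
    using sum_coefficient_le_norm[OF W, of x] by linarith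
qed simp

text \<open>The truncation is a compression, so its norm is at most the norm of \<open>T\<close>.\<close>

lemma abs_trunc_eigenvalue_le:
  assumes T: "bounded_clinear T" and r: "r \<in> trunc_eigenvalues N T"
  shows "\<bar>r\<bar> \<le> onorm T"
proof -
  obtain x where x: "x \<in> range (trunc_proj N)" "truncation N T x = complex_of_real r *\<^sub>C x" "x \<noteq> 0"
    using r by (auto simp: trunc_eigenvalues_def trunc_eigenspace_def)
  then have "trunc_proj N x = x"
    by (auto intro!: trunc_proj_idem simp: coefficient_trunc_proj)
  then have "trunc_proj N (T x) = complex_of_real r *\<^sub>C x"
    using x by (simp add: truncation_def)
  then have "\<bar>r\<bar> * norm x = norm (trunc_proj N (T x))"
    by (simp add: norm_scaleC)
  also have "\<dots> \<le> onorm T * norm x"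
    using norm_trunc_proj_le onorm[OF bounded_clinearD(1)[OF T]] order_trans by blast
  finally show ?thesis
    using x(3) by simp
qed

definition block_heads :: "'d \<Rightarrow> nat \<Rightarrow> 'd list set" where
  "block_heads a N = {v \<in> unprefixed a. length v \<le> N}"

lemma finite_block_heads: "finite (block_heads (a :: 'd :: finite) N)"
proof (rule rev_finite_subset)
  show "finite {v :: 'd list. length v \<le> N}"
    using finite_lists_length_le[of "UNIV :: 'd set" N] by simp
qed (auto simp: block_heads_def)

definition toeplitz_entry :: "(complex \<Rightarrow> complex) \<Rightarrow> nat \<Rightarrow> nat \<Rightarrow> complex" where
  "toeplitz_entry f k l = (if l \<le> k then fourier_coeff f (int (k - l)) else 0)
    + (if k \<le> l then cnj (fourier_coeff f (int (l - k))) else 0)"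

lemma toeplitz_matrix_entry: "k \<le> h \<Longrightarrow> l \<le> h \<Longrightarrow> toeplitz_matrix f h $$ (k, l) = toeplitz_entry f k l"
  by (auto simp: toeplitz_matrix_def toeplitz_entry_def Let_def)

text \<open>A nonempty head has \<open>d - 1\<close> choices for its first letter and \<open>d\<close> for each of the others.\<close>

lemma card_unprefixed:
  fixes a :: "'d::finite"
  shows "card {v \<in> unprefixed a. length v = m}
    = (if m = 0 then 1 else (CARD('d) - 1) * CARD('d) ^ (m - 1))"
proof (cases m)
  case 0
  then have "{v \<in> unprefixed a. length v = m} = {[]}"
    by (auto simp: unprefixed_def)
  then show ?thesis
    using 0 by simp
next
  case (Suc n)
  have "{v \<in> unprefixed a. length v = m} = (\<lambda>(b, u). b # u) ` ((UNIV - {a}) \<times> {u. length u = n})"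
    using Suc by (auto simp: unprefixed_def length_Suc_conv)
  also have "card \<dots> = card ((UNIV - {a}) \<times> {u :: 'd list. length u = n})"
    by (rule card_image) (auto simp: inj_on_def)
  also have "\<dots> = (CARD('d) - 1) * CARD('d) ^ n"
    using card_lists_length_eq[of "UNIV :: 'd set" n] by (simp add: card_cartesian_product)
  finally show ?thesis
    using Suc by simp
qed

context
  fixes T :: "'d::finite fock \<Rightarrow> 'd fock" and a :: 'd and f :: "complex \<Rightarrow> complex"
  assumes T: "bounded_clinear T"
    and entry: "\<And>k l v v'. v \<in> unprefixed a \<Longrightarrow> v' \<in> unprefixed a \<Longrightarrow>
      coefficient (T (\<xi> (replicate l a @ v))) (replicate k a @ v') = (if v
          = v' then toeplitz_entry f k l else 0)"
begin

text \<open>The vectors \<open>b(v, j) = \<Sum>\<^sub>k P\<^sub>k\<^sub>j \<xi>(a\<^sup>k v)\<close>, where \<open>P\<close> diagonalizes the Toeplitz matrix \<open>X\<^sub>h\<close> with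
  \<open>h = N - |v|\<close>, form an eigenbasis of \<open>T\<^sub>N\<close>: independence and spanning follow blockwise from
  \<open>Q P = 1\<close> and \<open>P Q = 1\<close>, and the eigenvalue equation from \<open>X\<^sub>h P = P diag(\<lambda>)\<close>.\<close>

lemma trunc_eigenspace_block_heads:
  fixes N :: nat
  defines "I \<equiv> SIGMA v:block_heads a N. {..N - length v}"
  defines "lam \<equiv> \<lambda>(v, j). toeplitz_eigenvalue f (N - length v) j"
  shows "fock.dim (trunc_eigenspace N T r) = card {i \<in> I. lam i = r}"
    and "r \<in> trunc_eigenvalues N T \<longleftrightarrow> (\<exists>i\<in>I. lam i = r)"
proof -
  have "\<forall>h. \<exists>P Q :: nat \<Rightarrow> nat \<Rightarrow> complex. \<forall>i\<le>h. \<forall>l\<le>h.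
      (\<Sum>k\<le>h. P i k * Q k l) = of_bool (i = l) \<and> (\<Sum>k\<le>h. Q i k * P k l) = of_bool (i = l) \<and>
      (\<Sum>m\<le>h. toeplitz_matrix f h $$ (i, m) * P m l)
          = complex_of_real (toeplitz_eigenvalue f h l) * P i l"
    by (intro allI toeplitz_diagonalization)
  then obtain P Q :: "nat \<Rightarrow> nat \<Rightarrow> nat \<Rightarrow> complex" where PQ: "\<forall>h. \<forall>i\<le>h. \<forall>l\<le>h.
      (\<Sum>k\<le>h. P h i k * Q h k l) = of_bool (i = l) \<and> (\<Sum>k\<le>h. Q h i k * P h k l) = of_bool (i = l) \<and>
      (\<Sum>m\<le>h. toeplitz_matrix f h $$ (i, m) * P h m l)
          = complex_of_real (toeplitz_eigenvalue f h l) * P h i l"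
    unfolding choice_iff by (elim exE) (rule that)
  have PQ1: "(\<Sum>k\<le>h. P h i k * Q h k l) = of_bool (i = l)"
    and QP1: "(\<Sum>k\<le>h. Q h i k * P h k l) = of_bool (i = l)"
    and XP: "(\<Sum>m\<le>h. toeplitz_entry f i m * P h m l)
        = complex_of_real (toeplitz_eigenvalue f h l) * P h i l"
    if "i \<le> h" "l \<le> h" for h i l
    using PQ[rule_format, OF that] that by (simp_all add: toeplitz_matrix_entry)
  define b where "b = (\<lambda>(v, j). \<Sum>k\<le>N - length v. P (N - length v) k j *\<^sub>C \<xi> (replicate k a @ v))"
  define comb where "comb = (\<lambda>\<alpha>. \<Sum>i\<in>I. \<alpha> i *\<^sub>C b i)"
  have I: "finite I"
    unfolding I_def using finite_block_heads by auto
  have block_headsD: "v \<in> unprefixed a" "length v \<le> N" if "v \<in> block_heads a N" for v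
    using that by (auto simp: block_heads_def)
  have coeff_b: "coefficient (b (v, j)) (replicate k a @ u)
      = (if v = u \<and> k \<le> N - length v then P (N - length v) k j else 0)"
    if "v \<in> block_heads a N" "u \<in> unprefixed a" for v j k u
  proof -
    have "coefficient (b (v, j)) (replicate k a @ u)
        = (\<Sum>l\<le>N - length v. if l = k then if v = u then P (N - length v) k j else 0 else 0)"
      unfolding b_def prod.case coefficient_sum
      by (intro sum.cong) (auto simp: coefficient_\<xi> replicate_append_eq_iff[OF that(2)
          block_headsD(1)[OF that(1)]])
    then show ?thesis
      by (simp add: sum.delta)
  qed
  have coeff_comb: "coefficient (comb \<alpha>) (replicate k a @ u)
      = (if k + length u \<le> N then \<Sum>j\<le>N - length u. \<alpha> (u, j) * P (N - length u) k j else 0)"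
    if u: "u \<in> unprefixed a" for \<alpha> k u
  proof -
    have "coefficient (comb \<alpha>) (replicate k a @ u)
        = (\<Sum>(v, j)\<in>I. \<alpha> (v, j) * (if v = u \<and> k \<le> N - length v then P (N - length v) k j else 0))"
      unfolding comb_def coefficient_sum
      by (intro sum.cong refl) (auto simp: I_def coeff_b[OF _ u])
    also have "\<dots> = (\<Sum>v\<in>block_heads a N. \<Sum>j\<le>N - length v.
        \<alpha> (v, j) * (if v = u \<and> k \<le> N - length v then P (N - length v) k j else 0))"
      unfolding I_def by (subst sum.Sigma) (auto simp: finite_block_heads)
    also have "\<dots> = (\<Sum>v\<in>block_heads a N. if v = u then
        (\<Sum>j\<le>N - length u. \<alpha> (u, j) * (if k \<le> N - length u then P (N - length u) k j else 0)) else 0)"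
      by (intro sum.cong) auto
    also have "\<dots> = (if u \<in> block_heads a N then
        (\<Sum>j\<le>N - length u. \<alpha> (u, j) * (if k \<le> N - length u then P (N - length u) k j else 0)) else 0)"
      by (simp add: sum.delta finite_block_heads)
    also have "\<dots> = (if k + length u \<le> N then \<Sum>j\<le>N - length u. \<alpha> (u, j) * P (N - length u) k j else 0)"
    proof -
      have "k + length u \<le> N \<longleftrightarrow> u \<in> block_heads a N \<and> k \<le> N - length u"
        using u by (auto simp: block_heads_def)
      then show ?thesis
        by (cases "k \<le> N - length u") simp_all
    qed
    finally show ?thesis .
  qed
  have indep: "\<alpha> i = 0" if \<alpha>: "comb \<alpha> = 0" and "i \<in> I" for \<alpha> i
  proof -
    obtain u l where i: "i = (u, l)" "u \<in> block_heads a N" "l \<le> N - length u"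
      using \<open>i \<in> I\<close> by (auto simp: I_def)
    let ?h = "N - length u"
    have zero: "(\<Sum>j\<le>?h. \<alpha> (u, j) * P ?h k j) = 0" if "k \<le> ?h" for k
      using coeff_comb[OF block_headsD(1)[OF i(2)], of \<alpha> k] that block_headsD(2)[OF i(2)]
      by (simp add: \<alpha> le_diff_conv2)
    have "\<alpha> (u, l) = (\<Sum>j\<le>?h. if j = l then \<alpha> (u, l) else 0)"
      using i(3) by simp
    also have "\<dots> = (\<Sum>j\<le>?h. \<alpha> (u, j) * (\<Sum>k\<le>?h. Q ?h l k * P ?h k j))"
      using i(3) by (intro sum.cong) (auto simp: QP1)
    also have "\<dots> = (\<Sum>j\<le>?h. \<Sum>k\<le>?h. Q ?h l k * (\<alpha> (u, j) * P ?h k j))"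
      by (simp add: sum_distrib_left mult_ac)
    also have "\<dots> = (\<Sum>k\<le>?h. Q ?h l k * (\<Sum>j\<le>?h. \<alpha> (u, j) * P ?h k j))"
      by (subst sum.swap) (simp add: sum_distrib_left)
    also have "\<dots> = 0"
      by (simp add: zero)
    finally show ?thesis
      by (simp add: i)
  qed
  have range_comb: "range (trunc_proj N) = range comb"
  proof (intro equalityI subsetI)
    fix x :: "'d fock"
    assume "x \<in> range (trunc_proj N)"
    then have x: "coefficient x w = 0" if "length w > N" for w
      using that by (auto simp: coefficient_trunc_proj)
    \<comment> \<open>The coordinates of \<open>x\<close> in block \<open>v\<close> are obtained by applying \<open>Q = P\<^sup>-\<^sup>1\<close>.\<close>
    define \<alpha> where "\<alpha> = (\<lambda>(v, j). \<Sum>k\<le>N - length v. Q (N - length v) j k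
        * coefficient x (replicate k a @ v))"
    have "coefficient x (replicate k a @ u) = coefficient (comb \<alpha>) (replicate k a @ u)"
      if u: "u \<in> unprefixed a" for k u
    proof (cases "k + length u \<le> N")
      case True
      let ?h = "N - length u"
      have k: "k \<le> ?h"
        using True by simp
      have "coefficient (comb \<alpha>) (replicate k a @ u)
          = (\<Sum>j\<le>?h. \<Sum>l\<le>?h. P ?h k j * Q ?h j l * coefficient x (replicate l a @ u))"
        using True by (simp add: coeff_comb[OF u] \<alpha>_def sum_distrib_left mult_ac)
      also have "\<dots> = (\<Sum>l\<le>?h. (\<Sum>j\<le>?h. P ?h k j * Q ?h j l) * coefficient x (replicate l a @ u))"
        by (subst sum.swap) (simp add: sum_distrib_right)
      also have "\<dots> = (\<Sum>l\<le>?h. if l = k then coefficient x (replicate k a @ u) else 0)"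
        using k by (intro sum.cong) (auto simp: PQ1)
      finally show ?thesis
        using k by simp
    qed (simp add: coeff_comb[OF u] x)
    note eq = this
    have "x = comb \<alpha>"
    proof (rule fock_eqI)
      fix w
      obtain k u where "w = replicate k a @ u" "u \<in> unprefixed a"
        by (rule word_decomposition)
      then show "coefficient x w = coefficient (comb \<alpha>) w"
        by (simp only: eq)
    qed
    then show "x \<in> range comb"
      by (rule range_eqI[of x comb \<alpha>])
  next
    fix x
    assume "x \<in> range comb"
    then obtain \<alpha> where x: "x = comb \<alpha>"
      by blast
    have "coefficient x w = 0" if "length w > N" for w
    proof -
      obtain k u where "w = replicate k a @ u" "u \<in> unprefixed a"
        by (rule word_decomposition)
      then show ?thesis
        using that by (simp add: x coeff_comb)
    qed
    then have "trunc_proj N x = x"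
      by (rule trunc_proj_idem)
    then show "x \<in> range (trunc_proj N)"
      by (intro range_eqI[of _ _ x]) simp
  qed
  have T_b: "coefficient (T (b (v, j))) (replicate k a @ u)
      = of_real (lam (v, j)) * coefficient (b (v, j)) (replicate k a @ u)"
    if vj: "(v, j) \<in> I" and u: "u \<in> unprefixed a" and k: "k + length u \<le> N" for v j k u
  proof -
    let ?h = "N - length v"
    have v: "v \<in> block_heads a N" "j \<le> ?h"
      using vj by (auto simp: I_def)
    have "coefficient (T (b (v, j))) (replicate k a @ u)
        = (\<Sum>l\<le>?h. P ?h l j * (if v = u then toeplitz_entry f k l else 0))"
      unfolding b_def prod.case bounded_clinearD(6,4)[OF T] coefficient_sum
      by (simp add: entry[OF block_headsD(1)[OF v(1)] u])
    also have "\<dots> = (if v = u then \<Sum>l\<le>?h. toeplitz_entry f k l * P ?h l j else 0)"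
      by (simp add: mult.commute)
    also have "\<dots> = (if v = u then of_real (lam (v, j)) * P ?h k j else 0)"
      using k v by (auto simp: XP lam_def)
    also have "\<dots> = of_real (lam (v, j)) * coefficient (b (v, j)) (replicate k a @ u)"
      using k by (auto simp: coeff_b[OF v(1) u])
    finally show ?thesis .
  qed
  have A: "truncation N T (comb \<alpha>) = comb (\<lambda>i. of_real (lam i) * \<alpha> i)" for \<alpha>
  proof -
    have proj: "trunc_proj N (comb \<beta>) = comb \<beta>" for \<beta>
    proof -
      have "comb \<beta> \<in> range (trunc_proj N)"
        by (simp add: range_comb)
      then show ?thesis
        by (auto intro!: trunc_proj_idem simp: coefficient_trunc_proj)
    qed
    have "trunc_proj N (T (comb \<alpha>)) = trunc_proj N (comb (\<lambda>i. of_real (lam i) * \<alpha> i))"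
    proof (rule fock_eqI)
      fix w
      obtain k u where w: "w = replicate k a @ u" "u \<in> unprefixed a"
        by (rule word_decomposition)
      have "coefficient (T (comb \<alpha>)) w = coefficient (comb (\<lambda>i. of_real (lam i) * \<alpha> i)) w"
        if "length w \<le> N"
      proof -
        have "\<alpha> i * coefficient (T (b i)) w = of_real (lam i) * \<alpha> i * coefficient (b i) w"
            if "i \<in> I" for i
        proof -
          obtain v j where "i = (v, j)"
            by force
          then show ?thesis
            using T_b[of v j u k] that w \<open>length w \<le> N\<close> by simp
        qed
        then show ?thesis
          unfolding comb_def bounded_clinearD(6,4)[OF T] coefficient_sum
          by (intro sum.cong) (simp_all add: bounded_clinearD(4)[OF T])
      qed
      then show "coefficient (trunc_proj N (T (comb \<alpha>))) w
          = coefficient (trunc_proj N (comb (\<lambda>i. of_real (lam i) * \<alpha> i))) w"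
        by (simp add: coefficient_trunc_proj)
    qed
    then show ?thesis
      by (simp add: truncation_def proj)
  qed
  show "fock.dim (trunc_eigenspace N T r) = card {i \<in> I. lam i = r}"
    by (rule eigenspace_of_eigenbasis(1)[where I = I and comb = comb and b = b and lam = lam
          and A = "truncation N T" and U = "range (trunc_proj N)"])
      (fact I comb_def indep A range_comb trunc_eigenspace_def)+
  show "r \<in> trunc_eigenvalues N T \<longleftrightarrow> (\<exists>i\<in>I. lam i = r)"
    unfolding trunc_eigenvalues_def mem_Collect_eq
    by (rule eigenspace_of_eigenbasis(2)[where I = I and comb = comb and b = b and lam = lam
          and A = "truncation N T" and U = "range (trunc_proj N)"])
      (fact I comb_def indep A range_comb trunc_eigenspace_def)+
qed

text \<open>With \<open>N = h\<close> the empty word is the head of a block of size \<open>h + 1\<close>, so every eigenvalue of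
  \<open>X\<^sub>h\<close> is an eigenvalue of a truncation. This bounds the spectra of all \<open>X\<^sub>h\<close> simultaneously.\<close>

lemma abs_toeplitz_eigenvalue_le:
  assumes "j \<le> h"
  shows "\<bar>toeplitz_eigenvalue f h j\<bar> \<le> onorm T"
proof (rule abs_trunc_eigenvalue_le[OF T])
  show "toeplitz_eigenvalue f h j \<in> trunc_eigenvalues h T"
    unfolding trunc_eigenspace_block_heads
    by (rule bexI[of _ "([], j)"]) (use assms in \<open>auto simp: block_heads_def unprefixed_def\<close>)
qed

text \<open>Group the eigenbasis first by eigenvalue and then by the size of the block.\<close>

lemma sum_trunc_eigenvalues:
  fixes g :: "real \<Rightarrow> complex"
  shows "(\<Sum>r\<in>trunc_eigenvalues N T. of_nat (fock.dim (trunc_eigenspace N T r)) * g r)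
    = (\<Sum>h\<le>N. of_nat (card {v \<in> unprefixed a. length v = N - h}) * (\<Sum>j\<le>h. g (toeplitz_eigenvalue f h j)))"
proof -
  let ?I = "SIGMA v:block_heads a N. {..N - length v}"
  let ?lam = "\<lambda>(v, j). toeplitz_eigenvalue f (N - length v) j"
  let ?S = "\<lambda>h. \<Sum>j\<le>h. g (toeplitz_eigenvalue f h j)"
  have "trunc_eigenvalues N T = ?lam ` ?I"
    by (rule Set.set_eqI) (auto simp: trunc_eigenspace_block_heads(2) image_iff)
  then have "(\<Sum>r\<in>trunc_eigenvalues N T. of_nat (fock.dim (trunc_eigenspace N T r)) * g r)
      = (\<Sum>r\<in>?lam ` ?I. of_nat (card {i \<in> ?I. ?lam i = r}) * g r)"
    unfolding trunc_eigenspace_block_heads(1) by (rule sum.cong) simp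
  also have "\<dots> = (\<Sum>r\<in>?lam ` ?I. \<Sum>i | i \<in> ?I \<and> ?lam i = r. g (?lam i))"
    by (intro sum.cong) simp_all
  also have "\<dots> = (\<Sum>i\<in>?I. g (?lam i))"
    by (rule sum.image_gen[symmetric]) (use finite_block_heads in auto)
  also have "\<dots> = (\<Sum>v\<in>block_heads a N. ?S (N - length v))"
    by (subst sum.Sigma) (auto simp: finite_block_heads case_prod_unfold)
  also have "\<dots> = (\<Sum>h\<in>(\<lambda>v. N - length v) ` block_heads a N. \<Sum>v | v \<in> block_heads a N \<and> N - length v
      = h. ?S (N - length v))"
    by (rule sum.image_gen) (rule finite_block_heads)
  also have "\<dots> = (\<Sum>h\<le>N. \<Sum>v | v \<in> block_heads a N \<and> N - length v = h. ?S (N - length v))"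
  proof (rule sum.mono_neutral_left)
    show "\<forall>h\<in>{..N} - (\<lambda>v. N - length v) ` block_heads a N.
        (\<Sum>v | v \<in> block_heads a N \<and> N - length v = h. ?S (N - length v)) = 0"
      by (intro ballI sum.neutral) auto
  qed auto
  also have "\<dots> = (\<Sum>h\<le>N. of_nat (card {v \<in> unprefixed a. length v = N - h}) * ?S h)"
  proof (rule sum.cong)
    fix h
    assume "h \<in> {..N}"
    then have "{v. v \<in> block_heads a N \<and> N - length v = h} = {v \<in> unprefixed a. length v = N - h}"
      by (auto simp: block_heads_def)
    moreover have "(\<Sum>v | v \<in> block_heads a N \<and> N - length v = h. ?S (N - length v))
        = (\<Sum>v | v \<in> block_heads a N \<and> N - length v = h. ?S h)"
      by (rule sum.cong) auto
    ultimately show "(\<Sum>v | v \<in> block_heads a N \<and> N - length v = h. ?S (N - length v))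
        = of_nat (card {v \<in> unprefixed a. length v = N - h}) * ?S h"
      by (simp only: sum_constant)
  qed simp
  finally show ?thesis .
qed

end

section \<open>The atomic limit\<close>

text \<open>The limiting weight of the \<open>j\<close>-th eigenvalue of \<open>X\<^sub>h\<close>. These weights form a probability
  distribution on the pairs \<open>j \<le> h\<close>, whose image under the eigenvalue map is the limiting
  distribution. Integrals against the latter thus become integrals over a discrete space, to which
  dominated convergence applies.\<close>

definition block_weight :: "nat \<Rightarrow> nat \<times> nat \<Rightarrow> real" where
  "block_weight d = (\<lambda>(h, j). if j \<le> h then (1 - 1 / real d)\<^sup>2 * (1 / real d) ^ h else 0)"

lemma nn_integral_block_weight:
  fixes F :: "nat \<times> nat \<Rightarrow> ennreal"
  shows "(\<integral>\<^sup>+z. ennreal (block_weight d z) * F z \<partial>count_space UNIV)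
    = ennreal ((1 - 1 / real d)\<^sup>2) * (\<Sum>h. ennreal ((1 / real d) ^ h) * (\<Sum>j\<le>h. F (h, j)))"
proof -
  have "(\<integral>\<^sup>+z. ennreal (block_weight d z) * F z \<partial>count_space UNIV)
      = (\<integral>\<^sup>+h. \<integral>\<^sup>+j. ennreal (block_weight d (h, j)) * F (h, j) \<partial>count_space UNIV \<partial>count_space UNIV)"
    by (rule nn_integral_fst_count_space[symmetric])
  also have "\<dots> = (\<integral>\<^sup>+h. ennreal ((1 - 1 / real d)\<^sup>2) * (ennreal ((1 / real d) ^ h) *
      (\<Sum>j\<le>h. F (h, j))) \<partial>count_space UNIV)"
  proof (rule nn_integral_cong)
    fix h :: nat
    have "(\<integral>\<^sup>+j. ennreal (block_weight d (h, j)) * F (h, j) \<partial>count_space UNIV)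
        = (\<Sum>j\<le>h. ennreal (block_weight d (h, j)) * F (h, j))"
      by (rule nn_integral_count_space') (auto simp: block_weight_def)
    also have "\<dots> = (\<Sum>j\<le>h. ennreal ((1 - 1 / real d)\<^sup>2 * (1 / real d) ^ h) * F (h, j))"
      by (intro sum.cong) (auto simp: block_weight_def)
    also have "\<dots> = ennreal ((1 - 1 / real d)\<^sup>2) * (ennreal ((1 / real d) ^ h) * (\<Sum>j\<le>h. F (h, j)))"
      by (simp add: sum_distrib_left ennreal_mult mult.assoc)
    finally show "(\<integral>\<^sup>+j. ennreal (block_weight d (h, j)) * F (h, j) \<partial>count_space UNIV)
        = ennreal ((1 - 1 / real d)\<^sup>2) * (ennreal ((1 / real d) ^ h) * (\<Sum>j\<le>h. F (h, j)))" .
  qed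
  also have "\<dots> = (\<Sum>h. ennreal ((1 - 1 / real d)\<^sup>2) * (ennreal ((1 / real d) ^ h) * (\<Sum>j\<le>h. F (h, j))))"
    by (rule nn_integral_count_space_nat)
  finally show ?thesis
    by simp
qed

definition block_pmf :: "nat \<Rightarrow> (nat \<times> nat) pmf" where
  "block_pmf d = embed_pmf (block_weight d)"

text \<open>The total mass is one because \<open>\<Sum>\<^sub>h (h + 1) x\<^sup>h = 1 / (1 - x)\<^sup>2\<close> at \<open>x = 1/d\<close>.\<close>

lemma pmf_block_pmf:
  assumes "d \<ge> 2"
  shows "pmf (block_pmf d) z = block_weight d z"
  unfolding block_pmf_def
proof (rule pmf_embed_pmf)
  show "block_weight d z \<ge> 0" for z
    by (cases z) (auto simp: block_weight_def)
  let ?x = "1 / real d"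
  have x: "0 < ?x" "?x < 1"
    using assms by auto
  have "(\<integral>\<^sup>+z. ennreal (block_weight d z) \<partial>count_space UNIV)
      = ennreal ((1 - ?x)\<^sup>2) * (\<Sum>h. ennreal (?x ^ h) * (\<Sum>j\<le>h. 1))"
    using nn_integral_block_weight[of d "\<lambda>_. 1"] by simp
  also have "(\<Sum>h. ennreal (?x ^ h) * (\<Sum>j\<le>h. 1)) = (\<Sum>h. ennreal (real (Suc h) * ?x ^ h))"
  proof (rule suminf_cong)
    fix h
    show "ennreal (?x ^ h) * (\<Sum>j\<le>h. 1) = ennreal (real (Suc h) * ?x ^ h)"
      by (subst ennreal_mult) (auto simp: ennreal_of_nat_eq_real_of_nat mult.commute)
  qed
  also have "\<dots> = ennreal (1 / (1 - ?x)\<^sup>2)"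
    using geometric_deriv_sums[of ?x] x by (intro suminf_ennreal_eq) auto
  also have "ennreal ((1 - ?x)\<^sup>2) * ennreal (1 / (1 - ?x)\<^sup>2) = ennreal ((1 - ?x)\<^sup>2 * (1 / (1 - ?x)\<^sup>2))"
    by (rule ennreal_mult[symmetric]) auto
  also have "(1 - ?x)\<^sup>2 * (1 / (1 - ?x)\<^sup>2) = 1"
    using x by simp
  finally show "(\<integral>\<^sup>+z. ennreal (block_weight d z) \<partial>count_space UNIV) = 1"
    by simp
qed

lemma set_block_pmf: "d \<ge> 2 \<Longrightarrow> (h, j) \<in> set_pmf (block_pmf d) \<longleftrightarrow> j \<le> h"
  by (auto simp: set_pmf_eq pmf_block_pmf block_weight_def)

text \<open>The measure \<open>(1 - 1/d)\<^sup>2 \<Sum>\<^sub>h d\<^sup>-\<^sup>h \<mu>\<^sub>h\<close>, where \<open>\<mu>\<^sub>h\<close> is the eigenvalue measure of \<open>X\<^sub>h\<close>.\<close>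

definition toeplitz_spectral_measure :: "(complex \<Rightarrow> complex) \<Rightarrow> nat \<Rightarrow> real measure" where
  "toeplitz_spectral_measure f d
      = distr (measure_pmf (block_pmf d)) borel (\<lambda>(h, j). toeplitz_eigenvalue f h j)"

lemma emeasure_toeplitz_spectral_measure:
  assumes d: "d \<ge> 2" and A: "A \<in> sets borel"
  shows "emeasure (toeplitz_spectral_measure f d) A
    = ennreal ((1 - 1 / real d)\<^sup>2) *
      (\<Sum>h. ennreal (1 / real d ^ h) * emeasure (eigenvalue_measure (toeplitz_matrix f h)) A)"
proof -
  let ?lam = "\<lambda>(h, j). toeplitz_eigenvalue f h j"
  have "emeasure (toeplitz_spectral_measure f d) A = emeasure (measure_pmf (block_pmf d)) (?lam -` A)"
    unfolding toeplitz_spectral_measure_def using A by (subst emeasure_distr) auto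
  also have "\<dots> = (\<integral>\<^sup>+z. indicator (?lam -` A) z \<partial>measure_pmf (block_pmf d))"
    by simp
  also have "\<dots> = (\<integral>\<^sup>+z. ennreal (block_weight d z) * indicator (?lam -` A) z \<partial>count_space UNIV)"
    by (simp only: nn_integral_measure_pmf pmf_block_pmf[OF d])
  also have "\<dots> = ennreal ((1 - 1 / real d)\<^sup>2) *
      (\<Sum>h. ennreal ((1 / real d) ^ h) * (\<Sum>j\<le>h. indicator (?lam -` A) (h, j)))"
    by (rule nn_integral_block_weight)
  also have "(\<lambda>h. ennreal ((1 / real d) ^ h) * (\<Sum>j\<le>h. indicator (?lam -` A) (h, j)))
      = (\<lambda>h. ennreal (1 / real d ^ h) * emeasure (eigenvalue_measure (toeplitz_matrix f h)) A)"
    by (simp add: emeasure_toeplitz_eigenvalue_measure[OF A] power_divide indicator_def)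
  finally show ?thesis .
qed

lemma purely_atomic_toeplitz_spectral_measure: "purely_atomic (toeplitz_spectral_measure f d)"
proof -
  let ?lam = "\<lambda>(h, j). toeplitz_eigenvalue f h j"
  let ?M = "toeplitz_spectral_measure f d"
  have C: "countable (range ?lam)"
    by (intro countable_image) simp
  then have "range ?lam \<in> sets borel"
    by (rule sets.countable[rotated]) auto
  moreover have "?lam -` (UNIV - range ?lam) = {}"
    by blast
  then have "emeasure ?M (space ?M - range ?lam) = 0"
    unfolding toeplitz_spectral_measure_def using \<open>range ?lam \<in> sets borel\<close>
    by (subst emeasure_distr) auto
  ultimately show ?thesis
    unfolding purely_atomic_def using C
    by (intro bexI[of _ "range ?lam"]) (auto simp: toeplitz_spectral_measure_def)
qed

text \<open>For \<open>N > h\<close> the quotient is \<open>(d - 1) d\<^sup>N\<^sup>-\<^sup>h\<^sup>-\<^sup>1\<close> divided by \<open>(d\<^sup>N\<^sup>+\<^sup>1 - 1) / (d - 1)\<close>.\<close>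

lemma block_proportion_tendsto:
  fixes a :: "'d::finite"
  assumes d: "CARD('d) \<ge> 2"
  shows "(\<lambda>N. real (card {v \<in> unprefixed a. length v = N - h}) / real (trunc_dim TYPE('d) N))
    \<longlonglongrightarrow> (1 - 1 / real CARD('d))\<^sup>2 * (1 / real CARD('d)) ^ h"
proof -
  define x where "x = real CARD('d)"
  have x: "x \<ge> 2"
    using d by (simp add: x_def)
  have "(\<lambda>N. (1 / x) ^ Suc N) \<longlonglongrightarrow> 0"
    using x by (intro LIMSEQ_Suc LIMSEQ_power_zero) auto
  then have "(\<lambda>N. (1 - 1 / x)\<^sup>2 * (1 / x) ^ h / (1 - (1 / x) ^ Suc N))
      \<longlonglongrightarrow> (1 - 1 / x)\<^sup>2 * (1 / x) ^ h / (1 - 0)"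
    by (intro tendsto_intros) auto
  moreover have "\<forall>\<^sub>F N in sequentially. (1 - 1 / x)\<^sup>2 * (1 / x) ^ h / (1 - (1 / x) ^ Suc N)
      = real (card {v \<in> unprefixed a. length v = N - h}) / real (trunc_dim TYPE('d) N)"
    using eventually_gt_at_top[of h]
  proof eventually_elim
    case (elim N)
    then obtain m where N: "N = h + Suc m"
      using less_imp_Suc_add by auto
    have card: "real (card {v \<in> unprefixed a. length v = N - h}) = (x - 1) * x ^ m"
      unfolding card_unprefixed using d by (simp add: N x_def of_nat_diff)
    have dim: "real (trunc_dim TYPE('d) N) = (x ^ Suc N - 1) / (x - 1)"
      using x geometric_sum[of x "Suc N"] by (simp add: trunc_dim_def x_def lessThan_Suc_atMost)
    have pos: "x ^ Suc N > 1"
      using x by (intro one_less_power) auto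
    have "(1 - 1 / x)\<^sup>2 * (1 / x) ^ h / (1 - (1 / x) ^ Suc N)
        = (x - 1)\<^sup>2 * (x ^ Suc N / (x\<^sup>2 * x ^ h)) / (x ^ Suc N - 1)"
      using x pos by (simp add: field_simps power2_eq_square)
    also have "x ^ Suc N / (x\<^sup>2 * x ^ h) = x ^ m"
      using x by (simp add: N power_add power2_eq_square)
    also have "(x - 1)\<^sup>2 * x ^ m / (x ^ Suc N - 1) = (x - 1) * x ^ m / ((x ^ Suc N - 1) / (x - 1))"
      using x by (simp add: power2_eq_square)
    finally show ?case
      unfolding card dim .
  qed
  ultimately show ?thesis
    by (auto simp: x_def[symmetric] intro: Lim_transform_eventually)
qed

lemma block_proportion_le:
  fixes a :: "'d::finite"
  assumes d: "CARD('d) \<ge> 2" and "h \<le> N"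
  shows "real (card {v \<in> unprefixed a. length v = N - h}) / real (trunc_dim TYPE('d) N)
      \<le> (1 / real CARD('d)) ^ h"
proof -
  have "card {v \<in> unprefixed a. length v = N - h} \<le> CARD('d) ^ (N - h)"
  proof (cases "N - h")
    case (Suc m)
    then show ?thesis
      using card_unprefixed[of a "N - h"] mult_le_mono1[of "CARD('d) - 1" "CARD('d)"] by simp
  qed (use card_unprefixed[of a "N - h"] in simp)
  then have "real (card {v \<in> unprefixed a. length v = N - h}) \<le> real CARD('d) ^ (N - h)"
    by (metis of_nat_le_iff of_nat_power)
  moreover have "CARD('d) ^ N \<le> trunc_dim TYPE('d) N"
    unfolding trunc_dim_def by (rule member_le_sum) auto
  then have "real CARD('d) ^ N \<le> real (trunc_dim TYPE('d) N)"
    by (metis of_nat_le_iff of_nat_power)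
  ultimately have "real (card {v \<in> unprefixed a. length v = N - h}) / real (trunc_dim TYPE('d) N)
      \<le> real CARD('d) ^ (N - h) / real CARD('d) ^ N"
    by (intro frac_le) auto
  also have "\<dots> = (1 / real CARD('d)) ^ h"
    using \<open>h \<le> N\<close> by (simp add: power_diff power_divide)
  finally show ?thesis .
qed

text \<open>The average of \<open>g\<close> over the eigenvalues of \<open>T\<^sub>N\<close> is the integral of \<open>g\<close>, composed with the
  eigenvalue map, against the block proportions at stage \<open>N\<close>. Relative to the limiting weights
  these proportions have a density bounded by \<open>(1 - 1/d)\<^sup>-\<^sup>2\<close> that converges pointwise to one. As
  \<open>g\<close> is bounded on the common interval \<open>[-\<parallel>T\<parallel>, \<parallel>T\<parallel>]\<close> of all eigenvalues, dominated convergence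
  applies.\<close>

lemma is_limiting_distribution_toeplitz_spectral_measure:
  fixes T :: "'d::finite fock \<Rightarrow> 'd fock" and a :: 'd
  assumes d: "CARD('d) \<ge> 2" and T: "bounded_clinear T"
    and entry: "\<And>k l v v'. v \<in> unprefixed a \<Longrightarrow> v' \<in> unprefixed a \<Longrightarrow>
      coefficient (T (\<xi> (replicate l a @ v))) (replicate k a @ v') = (if v
          = v' then toeplitz_entry f k l else 0)"
  shows "is_limiting_distribution T (toeplitz_spectral_measure f CARD('d))"
proof -
  let ?d = "CARD('d)"
  let ?p = "block_pmf ?d"
  let ?lam = "\<lambda>(h, j). toeplitz_eigenvalue f h j"
  let ?M = "toeplitz_spectral_measure f ?d"
  have lam: "?lam \<in> borel_measurable (measure_pmf ?p)"
    by simp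
  have "prob_space ?M"
    unfolding toeplitz_spectral_measure_def by (rule measure_pmf.prob_space_distr) simp
  moreover have "integrable ?M g
      \<and> (\<lambda>N. (\<Sum>r\<in>trunc_eigenvalues N T. of_nat (fock.dim (trunc_eigenspace N T r)) * g r)
      / of_nat (trunc_dim TYPE('d) N)) \<longlonglongrightarrow> (\<integral>t. g t \<partial>?M)"
    if g: "continuous_on UNIV g" for g :: "real \<Rightarrow> complex"
  proof
    have g_meas: "g \<in> borel_measurable borel"
      using g by (rule borel_measurable_continuous_onI)
    have "compact (g ` {- onorm T..onorm T})"
      by (intro compact_continuous_image continuous_on_subset[OF g]) auto
    then obtain C where C: "\<And>r. \<bar>r\<bar> \<le> onorm T \<Longrightarrow> cmod (g r) \<le> C"
      using compact_imp_bounded bounded_iff by (metis (no_types, lifting) abs_le_iff atLeastAtMost_iff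
          imageI minus_le_iff)
    have bound: "cmod (g (toeplitz_eigenvalue f h j)) \<le> C" if "j \<le> h" for h j
      by (intro C abs_toeplitz_eigenvalue_le[OF T entry] that)
    have C0: "C \<ge> 0"
      using bound[of 0 0] norm_ge_zero order_trans by blast
    have int: "integrable (measure_pmf ?p) (\<lambda>z. g (?lam z))"
      by (rule measure_pmf.integrable_const_bound[where B = C])
        (auto simp: AE_measure_pmf_iff set_block_pmf[OF d] bound)
    then show "integrable ?M g"
      unfolding toeplitz_spectral_measure_def by (subst integrable_distr_eq[OF lam g_meas])
    \<comment> \<open>\<open>q N h\<close> is the proportion of blocks of size \<open>h + 1\<close>, and \<open>s N\<close> is the integrand with the density.\<close>
    define q where "q = (\<lambda>N h. real (card {v \<in> unprefixed a. length v = N - h})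
      / real (trunc_dim TYPE('d) N))"
    define s where "s = (\<lambda>N z. if fst z \<le> N then
      complex_of_real (q N (fst z) / block_weight ?d z) * g (?lam z) else 0)"
    have weight: "block_weight ?d (h, j) = (1 - 1 / real ?d)\<^sup>2 * (1 / real ?d) ^ h"
      "block_weight ?d (h, j) > 0" if "j \<le> h" for h j
      using d that by (auto simp: block_weight_def)
    have sum: "(\<Sum>r\<in>trunc_eigenvalues N T. of_nat (fock.dim (trunc_eigenspace N T r)) * g r)
        / of_nat (trunc_dim TYPE('d) N) = (\<integral>z. s N z \<partial>measure_pmf ?p)" for N
    proof -
      let ?I = "SIGMA h:{..N}. {..h}"
      have "(\<integral>z. s N z \<partial>measure_pmf ?p) = (\<Sum>z\<in>?I. pmf ?p z *\<^sub>R s N z)"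
        by (rule integral_measure_pmf) (auto simp: set_block_pmf[OF d] s_def split: if_splits)
      also have "\<dots> = (\<Sum>(h, j)\<in>?I. complex_of_real (q N h) * g (toeplitz_eigenvalue f h j))"
      proof (rule sum.cong)
        fix z
        assume "z \<in> ?I"
        then obtain h j where z: "z = (h, j)" "j \<le> h" "h \<le> N"
          by auto
        then show "pmf ?p z *\<^sub>R s N z
            = (case z of (h, j) \<Rightarrow> complex_of_real (q N h) * g (toeplitz_eigenvalue f h j))"
          using weight(2)[OF z(2)] by (simp add: pmf_block_pmf[OF d] s_def scaleR_conv_of_real)
      qed simp
      also have "\<dots> = (\<Sum>h\<le>N. complex_of_real (q N h) * (\<Sum>j\<le>h. g (toeplitz_eigenvalue f h j)))"
        by (subst sum.Sigma[symmetric]) (auto simp: sum_distrib_left)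
      also have "\<dots> = (\<Sum>h\<le>N. of_nat (card {v \<in> unprefixed a. length v = N - h}) *
          (\<Sum>j\<le>h. g (toeplitz_eigenvalue f h j))) / of_nat (trunc_dim TYPE('d) N)"
        by (simp add: q_def sum_divide_distrib)
      also have "\<dots> = (\<Sum>r\<in>trunc_eigenvalues N T. of_nat (fock.dim (trunc_eigenspace N T r)) * g r)
          / of_nat (trunc_dim TYPE('d) N)"
        by (subst sum_trunc_eigenvalues[OF T entry]) simp_all
      finally show ?thesis
        by simp
    qed
    have "(\<lambda>N. \<integral>z. s N z \<partial>measure_pmf ?p) \<longlonglongrightarrow> (\<integral>z. g (?lam z) \<partial>measure_pmf ?p)"
    proof (rule integral_dominated_convergence[where w = "\<lambda>_. C / (1 - 1 / real ?d)\<^sup>2"])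
      show "AE z in measure_pmf ?p. (\<lambda>N. s N z) \<longlonglongrightarrow> g (?lam z)"
        unfolding AE_measure_pmf_iff
      proof
        fix z
        assume "z \<in> set_pmf ?p"
        then obtain h j where z: "z = (h, j)" "j \<le> h"
          by (cases z) (auto simp: set_block_pmf[OF d])
        have "(\<lambda>N. complex_of_real (q N h / block_weight ?d z) * g (?lam z))
            \<longlonglongrightarrow> complex_of_real (block_weight ?d z / block_weight ?d z) * g (?lam z)"
          using weight[OF z(2)] block_proportion_tendsto[OF d, of a h]
          by (intro tendsto_intros) (auto simp: q_def z)
        then have "(\<lambda>N. complex_of_real (q N h / block_weight ?d z) * g (?lam z)) \<longlonglongrightarrow> g (?lam z)"
          using weight(2)[OF z(2)] by (simp add: z)
        then show "(\<lambda>N. s N z) \<longlonglongrightarrow> g (?lam z)"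
        proof (rule Lim_transform_eventually)
          show "\<forall>\<^sub>F N in sequentially. complex_of_real (q N h / block_weight ?d z) * g (?lam z) = s N z"
            using eventually_ge_at_top[of h] by eventually_elim (simp add: s_def z)
        qed
      qed
      show "AE z in measure_pmf ?p. cmod (s N z) \<le> C / (1 - 1 / real ?d)\<^sup>2" for N
        unfolding AE_measure_pmf_iff
      proof
        fix z
        assume "z \<in> set_pmf ?p"
        then obtain h j where z: "z = (h, j)" "j \<le> h"
          by (cases z) (auto simp: set_block_pmf[OF d])
        show "cmod (s N z) \<le> C / (1 - 1 / real ?d)\<^sup>2"
        proof (cases "h \<le> N")
          case True
          have q: "0 \<le> q N h" "q N h \<le> (1 / real ?d) ^ h"
            using block_proportion_le[OF d True, of a] by (auto simp: q_def)
          have "q N h / block_weight ?d z \<le> (1 / real ?d) ^ h / block_weight ?d z"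
            using q weight(2)[OF z(2)] by (intro divide_right_mono) (auto simp: z)
          also have "\<dots> = 1 / (1 - 1 / real ?d)\<^sup>2"
            using d by (simp add: weight(1)[OF z(2)] z(1))
          finally have ratio: "q N h / block_weight ?d z \<le> 1 / (1 - 1 / real ?d)\<^sup>2" .
          have "cmod (s N z) = q N h / block_weight ?d z * cmod (g (toeplitz_eigenvalue f h j))"
            using True q weight(2)[OF z(2)] by (simp add: s_def z norm_mult norm_divide)
          also have "\<dots> \<le> 1 / (1 - 1 / real ?d)\<^sup>2 * C"
            using bound[OF z(2)] by (intro mult_mono ratio) auto
          finally show ?thesis
            by simp
        qed (use C0 in \<open>simp add: s_def z\<close>)
      qed
    qed simp_all
    then show "(\<lambda>N. (\<Sum>r\<in>trunc_eigenvalues N T. of_nat (fock.dim (trunc_eigenspace N T r)) * g r)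
        / of_nat (trunc_dim TYPE('d) N)) \<longlonglongrightarrow> (\<integral>t. g t \<partial>?M)"
      unfolding sum toeplitz_spectral_measure_def integral_distr[OF lam g_meas] .
  qed
  ultimately show ?thesis
    by (simp add: is_limiting_distribution_def toeplitz_spectral_measure_def)
qed

text \<open>The functions \<open>x \<mapsto> e\<^sup>i\<^sup>t\<^sup>x\<close> are among the test functions, so the characteristic functions
  agree.\<close>

lemma limiting_distribution_unique:
  assumes "is_limiting_distribution T \<mu>" "is_limiting_distribution T \<nu>"
  shows "\<mu> = \<nu>"
proof (rule Levy_uniqueness)
  show "real_distribution \<mu>" "real_distribution \<nu>"
    using assms by (auto simp: is_limiting_distribution_def real_distribution_def
        real_distribution_axioms_def)
  show "char \<mu> = char \<nu>"
  proof
    fix t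
    have "continuous_on UNIV (\<lambda>x. iexp (t * x))"
      by (intro continuous_intros)
    with assms show "char \<mu> t = char \<nu> t"
      unfolding char_def is_limiting_distribution_def by (metis (no_types, lifting) LIMSEQ_unique)
  qed
qed

theorem theorem3p2:
  fixes f :: "complex \<Rightarrow> complex"
    and a :: "'d::finite"
    and T :: "'d fock \<Rightarrow> 'd fock"
  assumes "CARD('d) \<ge> 2"
    and "continuous_on (sphere 0 1) f"
    and "\<forall>j<0. fourier_coeff f j = 0"
    and "T = (\<lambda>x. disk_calculus f (left_shift a) x + adj (disk_calculus f (left_shift a)) x)"
  shows "bounded_clinear T \<and> self_adjoint T \<and> multi_Toeplitz T \<and>
    (\<exists>!\<mu>. is_limiting_distribution T \<mu>) \<and>
    purely_atomic (limiting_distribution T) \<and>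
    (\<forall>A \<in> sets borel. emeasure (limiting_distribution T) A =
      ennreal ((1 - 1 / real CARD('d))\<^sup>2) *
        (\<Sum>h. ennreal (1 / real CARD('d) ^ h) * emeasure (eigenvalue_measure (toeplitz_matrix f h)) A))"
proof -
  define c where "c = (\<lambda>j. fourier_coeff f (int j))"
  obtain B where c: "convolution_bound c B" and F: "disk_calculus f (left_shift a) = shift_series c a"
    unfolding c_def by (rule disk_calculus_left_shift[OF assms(2,3)])
  note bounded = bounded_clinear_shift_series[OF c, of a]
  have T: "T = (\<lambda>x. shift_series c a x + adj (shift_series c a) x)"
    unfolding assms(4) F ..
  have T_bounded: "bounded_clinear T"
    unfolding T by (rule bounded_clinear_add_adj[OF bounded])
  have entry: "coefficient (T (\<xi> (replicate l a @ v))) (replicate k a @ v')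
      = (if v = v' then toeplitz_entry f k l else 0)"
    if "v \<in> unprefixed a" "v' \<in> unprefixed a" for k l v v'
    unfolding T coefficient_add_adj_shift_series[OF c that] by (simp add: toeplitz_entry_def c_def)
  let ?M = "toeplitz_spectral_measure f CARD('d)"
  have limit: "is_limiting_distribution T ?M"
    by (rule is_limiting_distribution_toeplitz_spectral_measure[OF assms(1) T_bounded entry])
  then have "\<exists>!\<mu>. is_limiting_distribution T \<mu>" "limiting_distribution T = ?M"
    unfolding limiting_distribution_def using limiting_distribution_unique by blast+
  moreover have "self_adjoint T"
    unfolding T by (rule self_adjoint_add_adj[OF bounded])
  moreover have "multi_Toeplitz T"
    unfolding T by (rule multi_Toeplitz_add_adj[OF bounded shift_series_right_shift[OF c]])
  ultimately show ?thesis
    using T_bounded purely_atomic_toeplitz_spectral_measure emeasure_toeplitz_spectral_measure[OF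
        assms(1)]
    by simp
qed

end
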